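(* Let $t\ge 2$ be an integer, let $s\ge 5$ be an odd integer, and let $p=(s-1)t+2$. Then $$r\!\left(K_{n,n},K_{p,p},p^2-st+1\right)=\Omega\!\left(n^{2-2/s}\right).$$
   Context: For graphs $G,H$ and an integer $q$ with $2\le q\le |E(H)|$, an $(H,q)$-coloring of $G$ is an edge-coloring of $G$ in which every subgraph of $G$ isomorphic to $H$ receives at least $q$ distinct colors; $r(G,H,q)$ is the minimum number of colors needed for $G$ to have an $(H,q)$-coloring. $K_{n,n}$, $K_{p,p}$ denote complete bipartite graphs. Asymptotic notation refers to $n\to\infty$ with $s,t$ fixed. *)

theory Defs
  imports Complex_Main "HOL-Library.Landau_Symbols"
begin

record 'a graph =
  verts :: "'a set"
  edges :: "'a set set"

definition simple_graph :: "'a graph \<Rightarrow> bool" where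
  "simple_graph G \<longleftrightarrow> (\<forall>e \<in> edges G. e \<subseteq> verts G \<and> card e = 2)"

definition subgraph :: "'a graph \<Rightarrow> 'a graph \<Rightarrow> bool" where
  "subgraph F G \<longleftrightarrow> simple_graph F \<and> verts F \<subseteq> verts G \<and> edges F \<subseteq> edges G"

definition isomorphic :: "'a graph \<Rightarrow> 'b graph \<Rightarrow> bool" where
  "isomorphic G H \<longleftrightarrow>
     (\<exists>f. bij_betw f (verts G) (verts H) \<and> edges H = (\<lambda>e. f ` e) ` edges G)"

definition complete_bipartite :: "nat \<Rightarrow> nat \<Rightarrow> (nat + nat) graph" where
  "complete_bipartite m n =
     \<lparr>verts = {..<m} <+> {..<n}, edges = {{Inl i, Inr j} | i j. i < m \<and> j < n}\<rparr>"

text \<open>Subgraphs are not required to be induced, and edge-colorings are not required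
  to be proper.\<close>

definition Hq_coloring ::
    "'a graph \<Rightarrow> 'b graph \<Rightarrow> nat \<Rightarrow> ('a set \<Rightarrow> nat) \<Rightarrow> bool" where
  "Hq_coloring G H q c \<longleftrightarrow>
     (\<forall>F. subgraph F G \<and> isomorphic F H \<longrightarrow> q \<le> card (c ` edges F))"

text \<open>The number \<open>r(G, H, q)\<close>; it is only meaningful for finite \<open>G\<close> and \<open>H\<close> and
  \<open>2 \<le> q \<le> |E(H)|\<close>. Under these conditions the minimum is over a nonempty set, see
  the lemma \<open>ramsey_r_attained\<close> below.\<close>

definition ramsey_r :: "'a graph \<Rightarrow> 'b graph \<Rightarrow> nat \<Rightarrow> nat" where
  "ramsey_r G H q =
     (LEAST k. \<exists>c. c ` edges G \<subseteq> {..<k} \<and> Hq_coloring G H q c)"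

lemma ramsey_r_attained:
  assumes "finite (edges G)" "q \<le> card (edges H)"
  shows "\<exists>c. c ` edges G \<subseteq> {..<ramsey_r G H q} \<and> Hq_coloring G H q c"
proof -
  obtain c :: "'a set \<Rightarrow> nat" where
    c: "bij_betw c (edges G) {0..<card (edges G)}"
    using ex_bij_betw_finite_nat[OF assms(1)] by blast
  have "q \<le> card (c ` edges F)" if F: "subgraph F G" "isomorphic F H" for F
  proof -
    have sub: "edges F \<subseteq> edges G" using F(1) by (simp add: subgraph_def)
    then have fin: "finite (edges F)" using assms(1) finite_subset by blast
    have "card (edges H) \<le> card (edges F)"
      using F(2) card_image_le[OF fin] by (auto simp: isomorphic_def)
    moreover have "card (c ` edges F) = card (edges F)"
      using c sub by (meson bij_betw_imp_inj_on card_image inj_on_subset)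
    ultimately show ?thesis using assms(2) by simp
  qed
  then have "c ` edges G \<subseteq> {..<card (edges G)} \<and> Hq_coloring G H q c"
    using c by (auto simp: Hq_coloring_def bij_betw_def)
  then have "\<exists>k c. c ` edges G \<subseteq> {..<k} \<and> Hq_coloring G H q c" by blast
  then show ?thesis unfolding ramsey_r_def by (rule LeastI_ex)
qed

end

theory Submission
  imports Defs "HOL-Analysis.Convex"
begin

text \<open>Suppose that few colors are used.  In the energy graph the vertices are pairs of vertices on
  one side of \<open>K\<^bsub>n,n\<^esub>\<close>, and \<open>(u\<^sub>1, u\<^sub>2)\<close> is adjacent to \<open>(w\<^sub>1, w\<^sub>2)\<close> when \<open>u\<^sub>1 w\<^sub>1\<close> and
  \<open>u\<^sub>2 w\<^sub>2\<close> have the same color; by Cauchy-Schwarz it is dense.  Each of its edges is a repeated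
  color, so a theta graph formed by \<open>t\<close> paths of length \<open>s\<close> would give \<open>s t\<close> repetitions on
  \<open>p + p\<close> vertices.  If there is no such configuration, then between any two vertices of the energy
  graph there are boundedly many paths of each length \<open>i \<le> s\<close>: otherwise \<open>t\<close> of them can be chosen
  greedily, and the resulting theta graph with short paths can be enlarged by pendant edges to the
  same vertex and edge count.  Counting paths of length \<open>s\<close> in a subgraph of large minimum degree
  then bounds this degree by \<open>O(n\<^bsup>2/s\<^esup>)\<close>.

  Greedy choices tolerate overlaps because an energy vertex contributes new repetitions as soon as
  one of its two coordinates is new; thus only the finitely many pairs of used vertices
  have to be avoided.\<close>

section \<open>Parity counts and subgraphs of large minimum degree\<close>

lemma card_even_less: "card {j \<in> {1..<i}. even j} = (i - 1) div 2"
proof (induction i)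
  case (Suc i)
  have "{j \<in> {1..<Suc i}. even j} =
      (if even i \<and> i \<ge> 1 then insert i {j \<in> {1..<i}. even j} else {j \<in> {1..<i}. even j})"
    by (auto simp: less_Suc_eq)
  then have "card {j \<in> {1..<Suc i}. even j} = (if even i \<and> i \<ge> 1 then Suc ((i - 1) div 2) else (i - 1) div 2)"
    using Suc by simp
  also have "\<dots> = (Suc i - 1) div 2" by presburger
  finally show ?case .
qed simp

lemma card_odd_less: "card {j \<in> {1..<i}. odd j} = i div 2"
proof (induction i)
  case (Suc i)
  have "{j \<in> {1..<Suc i}. odd j} =
      (if odd i then insert i {j \<in> {1..<i}. odd j} else {j \<in> {1..<i}. odd j})"
    by (auto simp: less_Suc_eq elim: oddE)
  then show ?case using Suc by (auto elim!: evenE oddE)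
qed simp

text \<open>Deleting a vertex with fewer than \<open>d\<close> neighbours destroys at most
  \<open>2 * d\<close> ordered pairs, so the strict density inequality survives each deletion; since
  it fails for the empty set, the deletions must stop earlier.\<close>

lemma min_degree_subgraph:
  fixes R :: "'a \<Rightarrow> 'a \<Rightarrow> bool"
  assumes "finite W" "\<And>u w. R u w \<longleftrightarrow> R w u"
    and "2 * d * card W < card {(u, w) \<in> W \<times> W. R u w}"
  shows "\<exists>Q\<subseteq>W. Q \<noteq> {} \<and> (\<forall>u\<in>Q. d \<le> card {w \<in> Q. R u w})"
  using assms(1,3)
proof (induction "card W" arbitrary: W rule: less_induct)
  case less
  show ?case
  proof (cases "\<forall>u\<in>W. d \<le> card {w \<in> W. R u w}")
    case True
    moreover have "W \<noteq> {}" using less.prems by auto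
    ultimately show ?thesis by blast
  next
    case False
    then obtain u where u: "u \<in> W" "card {w \<in> W. R u w} < d" by auto
    let ?N = "{w \<in> W. R u w}" and ?W = "W - {u}"
    have fin: "finite ?W" "finite {(v, w) \<in> ?W \<times> ?W. R v w}" "finite ?N"
      using less.prems(1) by (auto intro: finite_subset [of _ "W \<times> W"])
    have "{(v, w) \<in> W \<times> W. R v w} \<subseteq> {(v, w) \<in> ?W \<times> ?W. R v w} \<union> ({u} \<times> ?N \<union> ?N \<times> {u})"
      using assms(2) by blast
    then have "card {(v, w) \<in> W \<times> W. R v w} \<le> card ({(v, w) \<in> ?W \<times> ?W. R v w} \<union> ({u} \<times> ?N \<union> ?N \<times> {u}))"
      using fin by (intro card_mono) auto
    also have "\<dots> \<le> card {(v, w) \<in> ?W \<times> ?W. R v w} + (card ({u} \<times> ?N) + card (?N \<times> {u}))"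
      by (meson add_left_mono card_Un_le le_trans)
    also have "\<dots> \<le> card {(v, w) \<in> ?W \<times> ?W. R v w} + 2 * d"
      using u by (simp add: card_cartesian_product)
    finally have "2 * d * card W < card {(v, w) \<in> ?W \<times> ?W. R v w} + 2 * d"
      using less.prems(2) by linarith
    moreover have W: "card W = Suc (card ?W)"
      using less.prems(1) u(1) by (rule card.remove)
    ultimately have "2 * d * card ?W < card {(v, w) \<in> ?W \<times> ?W. R v w}" by simp
    then have "\<exists>Q\<subseteq>?W. Q \<noteq> {} \<and> (\<forall>u\<in>Q. d \<le> card {w \<in> Q. R u w})"
      using W fin by (intro less.hyps) auto
    then show ?thesis by blast
  qed
qed

subsection \<open>Repeated colors\<close>

text \<open>Taking \<open>col\<close> as a total symmetric function of two vertices spares any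
  orientation of edges; only its values on vertices from opposite sides are of interest.\<close>

locale bipartite_coloring =
  fixes side :: "'v \<Rightarrow> bool" and col :: "'v \<Rightarrow> 'v \<Rightarrow> 'c"
  assumes col_commute: "col u v = col v u"
begin

definition half :: "bool \<Rightarrow> 'v set \<Rightarrow> 'v set" where
  "half b U = {v \<in> U. side v = b}"

definition cross :: "'v set \<Rightarrow> ('v \<times> 'v) set" where
  "cross U = half True U \<times> half False U"

definition colors :: "'v set \<Rightarrow> 'c set" where
  "colors U = (\<lambda>(a, b). col a b) ` cross U"

text \<open>The additive form avoids truncated subtraction. For halves of size \<open>p\<close> and
  \<open>r = s * t\<close> it says that this copy of K_{p,p} has at most
  \<open>p\<^sup>2 - s * t\<close> colors, one fewer than demanded.\<close>

definition repeats :: "'v set \<Rightarrow> nat \<Rightarrow> bool" where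
  "repeats U r \<longleftrightarrow> card (colors U) + r \<le> card (cross U)"

lemma finite_half [simp]: "finite U \<Longrightarrow> finite (half b U)"
  by (simp add: half_def)

lemma half_subset: "half b U \<subseteq> U"
  by (auto simp: half_def)

lemma half_Un: "half b (U \<union> W) = half b U \<union> half b W"
  by (auto simp: half_def)

lemma card_halves:
  assumes "finite U"
  shows "card U = card (half b U) + card (half (\<not> b) U)"
proof -
  have "U = half b U \<union> half (\<not> b) U" "half b U \<inter> half (\<not> b) U = {}"
    by (auto simp: half_def)
  then show ?thesis
    using card_Un_disjoint [of "half b U" "half (\<not> b) U"] assms by simp
qed

lemma finite_cross [simp]: "finite U \<Longrightarrow> finite (cross U)"
  by (simp add: cross_def)

lemma finite_colors [simp]: "finite U \<Longrightarrow> finite (colors U)"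
  by (simp add: colors_def)

lemma repeats_0: "finite U \<Longrightarrow> repeats U 0"
  by (simp add: repeats_def colors_def card_image_le)

lemma repeats_mono: "repeats U r \<Longrightarrow> r' \<le> r \<Longrightarrow> repeats U r'"
  by (simp add: repeats_def)

lemma col_in_colors:
  assumes "a \<in> U" "b \<in> U" "side a \<noteq> side b"
  shows "col a b \<in> colors U"
proof (cases "side a")
  case True
  then have "(a, b) \<in> cross U" using assms by (auto simp: cross_def half_def)
  then show ?thesis unfolding colors_def by force
next
  case False
  then have "(b, a) \<in> cross U" using assms by (auto simp: cross_def half_def)
  then show ?thesis unfolding colors_def using col_commute by force
qed

text \<open>Each new edge at \<open>z\<close> brings at most one new color, and the edges to
  \<open>S\<close> bring none, so the excess of edges over colors grows by at least
  \<open>card S\<close>.\<close>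

lemma repeats_insert:
  assumes U: "finite U" "z \<notin> U" and r: "repeats U r"
    and S: "S \<subseteq> half (\<not> side z) U" "\<And>x. x \<in> S \<Longrightarrow> col z x \<in> colors U"
  shows "repeats (insert z U) (r + card S)"
proof -
  define T where "T = half (\<not> side z) U"
  define N where "N = (\<lambda>x. if side z then (z, x) else (x, z)) ` T"
  have "finite T" using U by (simp add: T_def)
  moreover from this have "finite S" using S(1) finite_subset by (auto simp: T_def)
  ultimately have fin: "finite T" "finite S" by auto
  have cr: "cross (insert z U) = cross U \<union> N"
    by (auto simp: cross_def N_def T_def half_def)
  have "cross U \<inter> N = {}"
    using U by (auto simp: cross_def N_def half_def split: if_splits)
  moreover have "card N = card T"
    unfolding N_def by (rule card_image) (auto simp: inj_on_def)
  ultimately have card_cr: "card (cross (insert z U)) = card (cross U) + card T"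
    unfolding cr using fin U by (subst card_Un_disjoint) (auto simp: N_def)
  have "colors (insert z U) \<subseteq> colors U \<union> col z ` (T - S)"
  proof
    fix k assume "k \<in> colors (insert z U)"
    then consider "k \<in> colors U" | x where "x \<in> T" "k = col z x"
      unfolding colors_def cr N_def using col_commute by (fastforce split: if_splits)
    then show "k \<in> colors U \<union> col z ` (T - S)"
      using S(2) by cases auto
  qed
  then have "card (colors (insert z U)) \<le> card (colors U \<union> col z ` (T - S))"
    using U fin by (intro card_mono) auto
  also have "\<dots> \<le> card (colors U) + card (T - S)"
    using card_Un_le [of "colors U" "col z ` (T - S)"] card_image_le [of "T - S" "col z"] fin
    by simp
  also have "card (T - S) = card T - card S"
    using S fin by (intro card_Diff_subset) (auto simp: T_def)
  finally have "card (colors (insert z U)) + card S \<le> card (colors U) + card T"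
    using card_mono [of T S] S fin by (auto simp: T_def)
  then show ?thesis
    using r card_cr by (simp add: repeats_def)
qed

lemma repeats_superset:
  assumes "finite W" "U \<subseteq> W" "repeats U r"
  shows "repeats W r"
proof -
  have "finite U" using assms finite_subset by blast
  have "repeats (U \<union> X) r" if "finite X" for X
    using that
  proof induction
    case (insert z X)
    then show ?case
      using repeats_insert [of "U \<union> X" z r "{}"] \<open>finite U\<close>
      by (cases "z \<in> U") (auto simp: insert_absorb)
  qed (use assms in simp)
  from this [of W] show ?thesis using assms by (simp add: Un_absorb1)
qed

section \<open>Adjacency of pairs and the repetitions gained by adding a pair\<close>

definition color_class :: "'v set \<Rightarrow> 'v \<Rightarrow> 'c \<Rightarrow> 'v set" where
  "color_class V u k = {w \<in> V. side w \<noteq> side u \<and> col u w = k}"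

fun coords :: "'v \<times> 'v \<Rightarrow> 'v set" where
  "coords (a, b) = {a, b}"

lemma finite_coords [simp]: "finite (coords w)"
  by (cases w) simp

lemma coords_subset_iff: "coords w \<subseteq> U \<longleftrightarrow> w \<in> U \<times> U"
  by (cases w) auto

text \<open>The conditions on sides and distinct coordinates make the two equally colored edges
  vertex-disjoint.\<close>

fun matched :: "'v \<times> 'v \<Rightarrow> 'v \<times> 'v \<Rightarrow> bool" where
  "matched (u1, u2) (w1, w2) \<longleftrightarrow> u1 \<noteq> u2 \<and> w1 \<noteq> w2 \<and> side u1 = side u2 \<and> side w1 = side w2 \<and>
     side u1 \<noteq> side w1 \<and> col u1 w1 = col u2 w2"

lemma matched_sym: "matched u w \<longleftrightarrow> matched w u"
proof -
  have "matched w u" if "matched u w" for u w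
  proof -
    obtain u1 u2 w1 w2 where "u = (u1, u2)" "w = (w1, w2)" by (cases u; cases w)
    then show ?thesis
      using that col_commute [of u1 w1] col_commute [of u2 w2] by auto
  qed
  then show ?thesis by blast
qed

text \<open>First \<open>w2\<close> is added, whether new or not, and then the new vertex
  \<open>w1\<close>. For \<open>(x, x')\<close> in \<open>Y\<close> the edge from \<open>w1\<close>
  to \<open>x\<close> repeats the color of the edge from \<open>w2\<close> to \<open>x'\<close>,
  which is present by then; injectivity of \<open>fst\<close> makes these edges distinct.\<close>

lemma repeats_Un_coords_aux:
  assumes U: "finite U" "w1 \<notin> U" and r: "repeats U r"
    and Y: "finite Y" "inj_on fst Y" "\<And>y. y \<in> Y \<Longrightarrow> matched (w1, w2) y \<and> coords y \<subseteq> U"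
    and w: "w1 \<noteq> w2"
  shows "repeats (U \<union> {w1, w2}) (r + card Y)"
proof -
  have "repeats (insert w2 U) r"
    by (rule repeats_superset [of _ U]) (use U r in auto)
  then have "repeats (insert w1 (insert w2 U)) (r + card (fst ` Y))"
  proof (rule repeats_insert [rotated 2])
    show "fst ` Y \<subseteq> half (\<not> side w1) (insert w2 U)"
      using Y(3) by (force simp: half_def)
    show "col w1 x \<in> colors (insert w2 U)" if "x \<in> fst ` Y" for x
    proof -
      obtain x' where x': "(x, x') \<in> Y" using \<open>x \<in> fst ` Y\<close> by auto
      then have "col w1 x = col w2 x'" "side w2 \<noteq> side x'" "x' \<in> U"
        using Y(3) [OF x'] by auto
      then show ?thesis by (simp add: col_in_colors)
    qed
  qed (use U w in auto)
  then show ?thesis by (simp add: card_image [OF Y(2)])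
qed

text \<open>One coordinate of \<open>w\<close> lies outside \<open>U\<close>. Swapping the
  coordinates of all pairs if necessary makes it the first one, which is why injectivity is assumed
  for both projections.\<close>

lemma repeats_Un_coords:
  assumes "finite U" "repeats U r" "\<not> coords w \<subseteq> U" "finite Y"
    and Y: "inj_on fst Y" "inj_on snd Y" "\<And>y. y \<in> Y \<Longrightarrow> matched w y \<and> coords y \<subseteq> U"
    and "Y \<noteq> {}"
  shows "repeats (U \<union> coords w) (r + card Y)"
proof -
  obtain w1 w2 where w: "w = (w1, w2)" by (cases w)
  obtain y where "y \<in> Y" using \<open>Y \<noteq> {}\<close> by auto
  then have ne: "w1 \<noteq> w2"
    using Y(3) [of y] w by (cases y) auto
  show ?thesis
  proof (cases "w1 \<in> U")
    case False
    then show ?thesis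
      using repeats_Un_coords_aux [of U w1 r Y w2] assms w ne by simp
  next
    case True
    then have "w2 \<notin> U" using assms w by auto
    have inj: "inj_on fst (prod.swap ` Y)"
      using Y(2) by (auto simp: inj_on_def)
    have "matched (w2, w1) y \<and> coords y \<subseteq> U" if "y \<in> prod.swap ` Y" for y
      using that Y(3) w by fastforce
    then have "repeats (U \<union> {w2, w1}) (r + card (prod.swap ` Y))"
      using \<open>w2 \<notin> U\<close> assms ne inj by (intro repeats_Un_coords_aux) auto
    moreover have "card (prod.swap ` Y) = card Y"
      by (rule card_image) simp
    ultimately show ?thesis by (simp add: w insert_commute)
  qed
qed

lemma repeats_Un_pendant:
  assumes "finite U" "repeats U r" "\<not> coords w \<subseteq> U" "matched w u" "coords u \<subseteq> U"
  shows "repeats (U \<union> coords w) (Suc r)"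
  using repeats_Un_coords [of U r w "{u}"] assms by simp

text \<open>Inner vertices are added from the \<open>u\<close> end. Each is pendant to its
  predecessor and gives one repetition, except the last, which is also matched to \<open>y\<close>
  and gives two. Disjoint coordinates ensure that adding one inner vertex does not swallow a later
  one.\<close>

lemma repeats_Un_path:
  assumes "finite U" "repeats U r" "coords u \<subseteq> U" "coords y \<subseteq> U"
    and "successively matched (u # ws @ [y])"
    and "sorted_wrt (\<lambda>v w. coords v \<inter> coords w = {}) (u # ws @ [y])"
    and "\<And>w. w \<in> set ws \<Longrightarrow> \<not> coords w \<subseteq> U" and "ws \<noteq> []"
  shows "repeats (U \<union> \<Union> (coords ` set ws)) (Suc (r + length ws))"
  using assms
proof (induction ws arbitrary: U u r)
  case (Cons w ws)
  show ?case
  proof (cases "ws = []")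
    case True
    obtain u1 u2 y1 y2 where uy: "u = (u1, u2)" "y = (y1, y2)" by (cases u; cases y)
    have "matched w u" "matched w y" "coords u \<inter> coords y = {}"
      using Cons.prems True by (auto simp: matched_sym)
    then have "repeats (U \<union> coords w) (r + card {u, y})"
      using Cons.prems True by (intro repeats_Un_coords) (auto simp: uy)
    moreover have "card {u, y} = 2"
      using \<open>coords u \<inter> coords y = {}\<close> by (auto simp: uy)
    ultimately show ?thesis using True by simp
  next
    case False
    have "matched w u"
      using Cons.prems by (auto simp: matched_sym)
    then have "repeats (U \<union> coords w) (Suc r)"
      using Cons.prems by (intro repeats_Un_pendant [where u = u]) auto
    then have "repeats ((U \<union> coords w) \<union> \<Union> (coords ` set ws)) (Suc (Suc r + length ws))"
    proof (rule Cons.IH [rotated])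
      show "\<not> coords v \<subseteq> U \<union> coords w" if "v \<in> set ws" for v
        using Cons.prems(6) Cons.prems(7) [of v] that by fastforce
    qed (use Cons.prems False in auto)
    then show ?thesis by (simp add: Un_assoc)
  qed
qed simp

section \<open>Sides of energy vertices and the gain from a whole path\<close>

definition pside :: "'v \<times> 'v \<Rightarrow> bool" where
  "pside u = side (fst u)"

lemma side_coords: "matched u w \<Longrightarrow> x \<in> coords u \<Longrightarrow> side x = pside u"
  by (cases u; cases w) (auto simp: pside_def)

lemma card_coords_le: "card (coords u) \<le> 2"
  by (cases u) (auto simp: card_insert_if)

lemma card_half_coords:
  assumes "matched u w"
  shows "card (half b (coords u)) \<le> 2 * of_bool (pside u = b)"
proof -
  have "half b (coords u) = (if pside u = b then coords u else {})"
    using side_coords [OF assms] by (auto simp: half_def)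
  then show ?thesis using card_coords_le by simp
qed

lemma pside_matched: "matched u w \<Longrightarrow> pside w = (\<not> pside u)"
  by (cases u; cases w) (auto simp: pside_def)

definition clear :: "'v \<times> 'v \<Rightarrow> 'v \<times> 'v \<Rightarrow> bool" where
  "clear u w \<longleftrightarrow> coords u \<inter> coords w = {}"

lemma pside_nth:
  assumes "successively matched xs" "j < length xs"
  shows "pside (xs ! j) = (pside (xs ! 0) = even j)"
  using assms(2)
proof (induction j)
  case (Suc j)
  then have "matched (xs ! j) (xs ! Suc j)"
    using assms(1) by (simp add: successively_conv_nth)
  then show ?case using Suc pside_matched by auto
qed simp

text \<open>Sides alternate along a path, so the inner positions on the side of \<open>hd xs\<close>
  are the even ones, and each position adds at most two vertices. Separate bounds for the two halves
  are needed because both halves must finally fit into \<open>p\<close>.\<close>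

lemma repeats_Un_full_path:
  assumes U: "finite U" "repeats U r"
    and xs: "successively matched xs" "sorted_wrt clear xs" "length xs = Suc i" "i \<ge> 2"
    and ends: "coords (hd xs) \<subseteq> U" "coords (last xs) \<subseteq> U"
    and new: "\<And>j. j \<in> {1..<i} \<Longrightarrow> \<not> coords (xs ! j) \<subseteq> U"
  defines "X \<equiv> U \<union> (\<Union>j\<in>{1..<i}. coords (xs ! j))"
  shows "repeats X (r + i)"
    and "card (half b X) \<le> card (half b U) + 2 * (if b = pside (hd xs) then (i - 1) div 2 else i div 2)"
proof -
  obtain u xs' where "xs = u # xs'" using xs by (cases xs) auto
  moreover from this obtain ws y where "xs' = ws @ [y]" using xs by (cases xs' rule: rev_cases) auto
  ultimately have eq: "xs = u # ws @ [y]" by simp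
  have len: "i = Suc (length ws)" using xs eq by simp
  have nth: "xs ! Suc j = ws ! j" if "j < length ws" for j
    using that by (simp add: eq nth_append)
  have ws: "set ws = (\<lambda>j. xs ! j) ` {1..<i}"
  proof -
    have "{1..<i} = Suc ` {..<length ws}" by (simp add: len lessThan_atLeast0 image_Suc_atLeastLessThan)
    then show ?thesis using nth by (force simp: set_conv_nth image_image)
  qed
  have "repeats (U \<union> \<Union> (coords ` set ws)) (Suc (r + length ws))"
  proof (rule repeats_Un_path [where u = u and y = y])
    show "sorted_wrt (\<lambda>v w. coords v \<inter> coords w = {}) (u # ws @ [y])"
      using xs(2) by (simp add: eq clear_def [abs_def])
  qed (use assms eq len ws in auto)
  moreover have "U \<union> \<Union> (coords ` set ws) = X"
    by (simp add: ws X_def)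
  ultimately show "repeats X (r + i)" by (simp add: len)
  let ?J = "{j \<in> {1..<i}. (pside (hd xs) = even j) = b}"
  have side: "side v = (pside (hd xs) = even j)" if "v \<in> coords (xs ! j)" "j \<in> {1..<i}" for v j
  proof -
    have "matched (xs ! j) (xs ! Suc j)"
      using xs that by (simp add: successively_conv_nth)
    then have "side v = pside (xs ! j)" using that side_coords by blast
    then show ?thesis using pside_nth [OF xs(1), of j] that xs(3) by (simp add: eq)
  qed
  \<comment> \<open>\<open>?J\<close> collects the inner positions whose energy vertices lie on side
    \<open>b\<close>.\<close>
  have "half b X \<subseteq> half b U \<union> (\<Union>j\<in>?J. coords (xs ! j))"
    using side by (force simp: X_def half_def)
  then have "card (half b X) \<le> card (half b U \<union> (\<Union>j\<in>?J. coords (xs ! j)))"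
    using U by (intro card_mono) auto
  also have "\<dots> \<le> card (half b U) + card (\<Union>j\<in>?J. coords (xs ! j))"
    by (rule card_Un_le)
  also have "card (\<Union>j\<in>?J. coords (xs ! j)) \<le> (\<Sum>j\<in>?J. card (coords (xs ! j)))"
    by (rule card_UN_le) simp
  also have "\<dots> \<le> (\<Sum>j\<in>?J. 2)" by (intro sum_mono card_coords_le)
  also have "\<dots> = 2 * card ?J" by simp
  also have "?J = (if b = pside (hd xs) then {j \<in> {1..<i}. even j} else {j \<in> {1..<i}. odd j})"
    by auto
  also have "card \<dots> = (if b = pside (hd xs) then (i - 1) div 2 else i div 2)"
    by (simp only: card_even_less card_odd_less if_distrib [of card])
  finally show "card (half b X) \<le> card (half b U) + 2 * (if b = pside (hd xs) then (i - 1) div 2 else i div 2)"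
    by simp
qed

end

subsection \<open>Large monochromatic stars\<close>

text \<open>The setting of a valid coloring: \<open>V\<close> is the vertex set of K_{n,n}, and
  \<open>not_repeats\<close> is the coloring condition on copies of K_{p,p}.\<close>

locale few_repeats = bipartite_coloring side col
  for side :: "'v \<Rightarrow> bool" and col :: "'v \<Rightarrow> 'v \<Rightarrow> 'c" +
  fixes V :: "'v set" and n s t p :: nat
  assumes finite_V: "finite V" and card_half_V: "\<And>b. card (half b V) = n"
    and t: "t \<ge> 2" and s: "s \<ge> 5" "odd s" and p: "p = (s - 1) * t + 2" and n: "n \<ge> p"
    and not_repeats: "\<And>U. U \<subseteq> V \<Longrightarrow> (\<And>b. card (half b U) = p) \<Longrightarrow> \<not> repeats U (s * t)"
begin

text \<open>Both halves can be padded inside \<open>V\<close> to exactly \<open>p\<close> vertices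
  since \<open>n \<ge> p\<close>, and repetitions survive the addition of vertices.\<close>

lemma not_repeats_le:
  assumes "U \<subseteq> V" "\<And>b. card (half b U) \<le> p"
  shows "\<not> repeats U (s * t)"
proof
  assume r: "repeats U (s * t)"
  have "\<exists>W. half b U \<subseteq> W \<and> W \<subseteq> half b V \<and> card W = p" for b
    using assms finite_V n card_half_V
    by (intro exists_subset_between) (auto simp: half_def)
  then obtain W where W: "\<And>b. half b U \<subseteq> W b" "\<And>b. W b \<subseteq> half b V" "\<And>b. card (W b) = p"
    by metis
  define X where "X = W True \<union> W False"
  have half_X: "half b X = W b" for b
    using W(2) by (cases b) (force simp: X_def half_def)+
  have "X \<subseteq> V" using W(2) half_subset by (fastforce simp: X_def)
  moreover have "U \<subseteq> X"
  proof
    fix v assume "v \<in> U"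
    then have "v \<in> W (side v)" using W(1) [of "side v"] by (auto simp: half_def)
    then show "v \<in> X" by (cases "side v") (auto simp: X_def)
  qed
  ultimately have "repeats X (s * t)"
    using repeats_superset [of X U] r finite_V finite_subset by blast
  then show False
    using not_repeats [OF \<open>X \<subseteq> V\<close>] half_X W(3) by simp
qed

lemma st_le: "s * t \<le> 2 * p - 2"
proof -
  have "s = Suc (Suc (s - 2))" using s by simp
  then obtain s' where "s = Suc (Suc s')" by blast
  then show ?thesis by (simp add: p algebra_simps)
qed

text \<open>In the copy of K_{p,p} on \<open>Z\<close> and \<open>W\<close>, the edges at
  \<open>w'\<close> repeat the \<open>p\<close> colors at \<open>w\<close>, and the star at
  \<open>z\<close> gives \<open>p - 2\<close> further repetitions. The total
  \<open>2 * p - 2\<close> is at least \<open>s * t\<close>.\<close>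

lemma not_star_pair:
  assumes Z: "Z \<subseteq> half b V" "card Z = p" "z \<in> Z"
    and W: "W \<subseteq> half (\<not> b) V" "card W = p" "w \<in> W" "w' \<in> W" "w \<noteq> w'"
    and zw: "\<And>x. x \<in> Z \<Longrightarrow> col x w = col x w'"
    and star: "\<And>v. v \<in> W \<Longrightarrow> col z v = col z w"
  shows False
proof -
  have fin: "finite Z" "finite W"
    using Z(1) W(1) finite_V finite_subset finite_half by blast+
  have side_Z: "side x = b" if "x \<in> Z" for x using that Z(1) by (auto simp: half_def)
  have side_W: "side x = (\<not> b)" if "x \<in> W" for x using that W(1) by (auto simp: half_def)
  have disj: "x \<notin> Z" if "x \<in> W" for x using side_Z side_W that by force
  define U where "U = insert w' (insert w Z)"
  have "repeats U (0 + card Z)"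
    unfolding U_def
  proof (rule repeats_insert)
    show "repeats (insert w Z) 0" using fin by (simp add: repeats_0)
    show "w' \<notin> insert w Z" using W disj by auto
    show "Z \<subseteq> half (\<not> side w') (insert w Z)" using side_Z side_W W by (auto simp: half_def)
    show "col w' x \<in> colors (insert w Z)" if "x \<in> Z" for x
      using col_in_colors [of x "insert w Z" w] that zw [OF that] side_Z side_W W
      by (auto simp: col_commute)
  qed (use fin in auto)
  then have r: "repeats U p" using Z by simp
  have "repeats (U \<union> X) (p + card X)" if "finite X" "X \<subseteq> W - {w, w'}" for X
    using that
  proof induction
    case (insert v X)
    then have v: "v \<in> W" "v \<noteq> w" "v \<noteq> w'" by auto
    have "repeats (insert v (U \<union> X)) (p + card X + card {z})"
    proof (rule repeats_insert)
      show "v \<notin> U \<union> X" using v insert disj by (auto simp: U_def)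
      show "{z} \<subseteq> half (\<not> side v) (U \<union> X)"
        using side_Z side_W v Z by (auto simp: half_def U_def)
      have "col z w \<in> colors (U \<union> X)"
        using side_Z side_W W Z by (intro col_in_colors) (auto simp: U_def)
      then show "col v x \<in> colors (U \<union> X)" if "x \<in> {z}" for x
        using that star [OF v(1)] by (simp add: col_commute)
    qed (use insert fin in \<open>auto simp: U_def\<close>)
    then show ?case using insert by simp
  qed (use r in simp)
  from this [of "W - {w, w'}"] have "repeats (U \<union> (W - {w, w'})) (p + card (W - {w, w'}))"
    using fin by simp
  moreover have "U \<union> (W - {w, w'}) = Z \<union> W" using W by (auto simp: U_def)
  moreover have "card (W - {w, w'}) = p - 2"
    using W fin by (subst card_Diff_subset) auto
  ultimately have "repeats (Z \<union> W) (s * t)"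
    using st_le by (auto elim!: repeats_mono)
  moreover have "Z \<union> W \<subseteq> V" using Z(1) W(1) half_subset by blast
  moreover have "half c (Z \<union> W) = (if c = b then Z else W)" for c
    using side_Z side_W by (auto simp: half_def)
  then have "card (half c (Z \<union> W)) = p" for c using Z W by simp
  ultimately show False using not_repeats by blast
qed

text \<open>Edges in large monochromatic stars are discarded: there are few of them by
  \<open>not_star_pair\<close>, and without them a vertex of the energy graph has boundedly many neighbours with
  a prescribed coordinate.\<close>

definition M :: nat where "M = 4 * p"

definition heavy :: "bool \<Rightarrow> ('v \<times> 'v) set" where
  "heavy b = {(z, w) \<in> half b V \<times> half (\<not> b) V. card (color_class V z (col z w)) > M}"

lemma finite_color_class [simp]: "finite (color_class V u k)"
  using finite_V by (simp add: color_class_def)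

lemma color_class_subset: "z \<in> half b V \<Longrightarrow> color_class V z k \<subseteq> half (\<not> b) V"
  by (auto simp: color_class_def half_def)

text \<open>Double counting of triples \<open>z\<close>, \<open>w\<close>, \<open>w'\<close> with
  \<open>(z, w)\<close> heavy and both edges at \<open>z\<close> of one color. Each heavy edge lies
  in at least \<open>M = 4 * p\<close> of them, so if more than a quarter of all edges were heavy,
  some pair \<open>w\<close>, \<open>w'\<close> would be served by at least \<open>p\<close>
  vertices \<open>z\<close>, as excluded by \<open>not_star_pair\<close>.\<close>

lemma card_heavy: "4 * card (heavy b) \<le> n\<^sup>2"
proof (rule ccontr)
  assume many: "\<not> 4 * card (heavy b) \<le> n\<^sup>2"
  define T where "T = Sigma (heavy b) (\<lambda>(z, w). color_class V z (col z w) - {w})"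
  define P where "P = half (\<not> b) V \<times> half (\<not> b) V"
  define F where "F q = {z \<in> half b V. col z (fst q) = col z (snd q) \<and> (z, fst q) \<in> heavy b}" for q
  have fin: "finite (heavy b)" "finite P"
    using finite_V by (auto simp: heavy_def P_def intro: finite_subset [of _ "V \<times> V"] half_subset [THEN subsetD])
  have "M * card (heavy b) = (\<Sum>e\<in>heavy b. M)" by simp
  also have "\<dots> \<le> (\<Sum>e\<in>heavy b. card (case e of (z, w) \<Rightarrow> color_class V z (col z w) - {w}))"
  proof (intro sum_mono)
    fix e assume "e \<in> heavy b"
    then show "M \<le> card (case e of (z, w) \<Rightarrow> color_class V z (col z w) - {w})"
      by (auto simp: heavy_def card_Diff_singleton_if)
  qed
  also have "\<dots> = card T"
    unfolding T_def using fin by (subst card_SigmaI) auto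
  finally have T1: "M * card (heavy b) \<le> card T" .
  have "T \<subseteq> (\<lambda>(q, z). ((z, fst q), snd q)) ` Sigma {q \<in> P. fst q \<noteq> snd q} F"
  proof clarify
    fix z w w' assume "((z, w), w') \<in> T"
    then have "((w, w'), z) \<in> Sigma {q \<in> P. fst q \<noteq> snd q} F"
      by (auto simp: T_def heavy_def P_def F_def color_class_def half_def)
    then show "((z, w), w') \<in> (\<lambda>(q, z). ((z, fst q), snd q)) ` Sigma {q \<in> P. fst q \<noteq> snd q} F"
      by (rule rev_image_eqI) simp
  qed
  then have "card T \<le> card (Sigma {q \<in> P. fst q \<noteq> snd q} F)"
    using fin finite_V by (intro surj_card_le) (auto simp: F_def)
  also have "\<dots> = (\<Sum>q\<in>{q \<in> P. fst q \<noteq> snd q}. card (F q))"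
    using fin finite_V by (intro card_SigmaI) (auto simp: F_def)
  finally have T2: "card T \<le> (\<Sum>q\<in>{q \<in> P. fst q \<noteq> snd q}. card (F q))" .
  have "\<exists>q\<in>P. fst q \<noteq> snd q \<and> p \<le> card (F q)"
  proof (rule ccontr)
    assume "\<not> ?thesis"
    then have "(\<Sum>q\<in>{q \<in> P. fst q \<noteq> snd q}. card (F q)) \<le> (\<Sum>q\<in>{q \<in> P. fst q \<noteq> snd q}. p)"
      by (intro sum_mono) (auto simp: not_le less_imp_le)
    also have "\<dots> = card {q \<in> P. fst q \<noteq> snd q} * p" by simp
    also have "\<dots> \<le> card P * p"
      using fin by (intro mult_right_mono card_mono) auto
    also have "card P = n\<^sup>2" by (simp add: P_def card_cartesian_product card_half_V power2_eq_square)
    finally have "M * card (heavy b) \<le> n\<^sup>2 * p"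
      using T1 T2 by linarith
    then have "p * (4 * card (heavy b)) \<le> p * n\<^sup>2"
      by (simp only: M_def mult_ac)
    moreover have "p > 0" using p by simp
    ultimately show False using many by (metis mult_le_cancel1)
  qed
  then obtain w w' where ww: "w \<in> half (\<not> b) V" "w' \<in> half (\<not> b) V" "w \<noteq> w'" "p \<le> card (F (w, w'))"
    by (auto simp: P_def)
  then obtain Z where Z: "Z \<subseteq> F (w, w')" "card Z = p"
    by (meson obtain_subset_with_card_n)
  then have "Z \<noteq> {}" using p by auto
  then obtain z where z: "z \<in> Z" by auto
  then have zF: "z \<in> F (w, w')" using Z by auto
  let ?C = "color_class V z (col z w)"
  have "{w, w'} \<subseteq> ?C"
    using zF ww by (auto simp: F_def color_class_def half_def)
  moreover have "p \<le> card ?C"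
    using zF by (auto simp: F_def heavy_def M_def)
  \<comment> \<open>The heavy color class at \<open>z\<close> is large enough to supply the second
    side, with both \<open>w\<close> and \<open>w'\<close> in it.\<close>
  ultimately have "\<exists>W. {w, w'} \<subseteq> W \<and> W \<subseteq> ?C \<and> card W = p"
    using p ww by (intro exists_subset_between) auto
  then obtain W where W: "{w, w'} \<subseteq> W" "W \<subseteq> ?C" "card W = p" by auto
  show False
  proof (rule not_star_pair [of Z b z W w w'])
    show "Z \<subseteq> half b V" using Z by (auto simp: F_def)
    show "W \<subseteq> half (\<not> b) V"
      using W(2) color_class_subset [of z b "col z w"] zF by (auto simp: F_def)
    show "col x w = col x w'" if "x \<in> Z" for x
      using that Z by (auto simp: F_def)
    show "col z v = col z w" if "v \<in> W" for v
      using that W by (auto simp: color_class_def)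
  qed (use Z z W ww in auto)
qed

section \<open>Light edges and bounded numbers of neighbours with a given coordinate\<close>

definition light :: "'v \<Rightarrow> 'v \<Rightarrow> bool" where
  "light u w \<longleftrightarrow> card (color_class V u (col u w)) \<le> M \<and> card (color_class V w (col u w)) \<le> M"

lemma light_sym: "light u w \<longleftrightarrow> light w u"
  by (auto simp: light_def col_commute [of u w])

definition light_edges :: "('v \<times> 'v) set" where
  "light_edges = {(a, b) \<in> cross V. light a b}"

text \<open>An edge that is not light is heavy as seen from one of its ends, and each of the two
  kinds accounts for at most a quarter of all edges.\<close>

lemma card_light_edges: "n\<^sup>2 \<le> 2 * card light_edges"
proof -
  have fin: "finite (cross V)" using finite_V by simp
  have sub: "heavy b \<subseteq> V \<times> V" for b using half_subset by (fastforce simp: heavy_def)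
  then have fin_heavy: "finite (heavy b)" for b
    using finite_V finite_subset by blast
  have "cross V \<subseteq> light_edges \<union> (heavy True \<union> prod.swap ` heavy False)"
  proof (rule subrelI)
    fix a b assume ab: "(a, b) \<in> cross V"
    then have "(a, b) \<in> light_edges \<or> (a, b) \<in> heavy True \<or> (b, a) \<in> heavy False"
      using col_commute [of a b]
      by (auto simp: cross_def light_edges_def heavy_def light_def not_less)
    then show "(a, b) \<in> light_edges \<union> (heavy True \<union> prod.swap ` heavy False)"
      by force
  qed
  then have "card (cross V) \<le> card (light_edges \<union> (heavy True \<union> prod.swap ` heavy False))"
    using fin fin_heavy
    by (intro card_mono) (auto simp: light_edges_def intro: finite_subset [of _ "cross V"])
  also have "\<dots> \<le> card light_edges + (card (heavy True) + card (prod.swap ` heavy False))"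
    by (meson add_left_mono card_Un_le le_trans)
  also have "card (prod.swap ` heavy False) = card (heavy False)"
    by (rule card_image) simp
  finally have "card (cross V) \<le> card light_edges + (card (heavy True) + card (heavy False))" .
  moreover have "card (cross V) = n\<^sup>2"
    by (simp add: cross_def card_cartesian_product card_half_V power2_eq_square)
  ultimately show ?thesis
    using card_heavy [of True] card_heavy [of False] by linarith
qed

definition adj :: "'v \<times> 'v \<Rightarrow> 'v \<times> 'v \<Rightarrow> bool" where
  "adj u w \<longleftrightarrow> matched u w \<and> coords u \<subseteq> V \<and> coords w \<subseteq> V \<and> light (fst u) (fst w) \<and> light (snd u) (snd w)"

lemma adj_sym: "adj u w \<longleftrightarrow> adj w u"
  unfolding adj_def using matched_sym light_sym by blast

lemma adj_swap: "adj (u1, u2) (w1, w2) \<longleftrightarrow> adj (u2, u1) (w2, w1)"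
  by (auto simp: adj_def)

text \<open>Once \<open>z\<close> is the first coordinate, the color is fixed, and the second
  coordinate lies in one color class at \<open>snd u\<close>. Any neighbour at all witnesses, by
  lightness, that this class has at most \<open>M\<close> elements.\<close>

lemma card_adj_fst: "card {w. adj u w \<and> fst w = z} \<le> M"
proof (cases "{w. adj u w \<and> fst w = z} = {}")
  case False
  obtain u1 u2 where u: "u = (u1, u2)" by (cases u)
  from False obtain w2 where "adj u (z, w2)" by force
  then have le: "card (color_class V u2 (col u1 z)) \<le> M"
    by (auto simp: adj_def u light_def)
  have "{w. adj u w \<and> fst w = z} \<subseteq> {z} \<times> color_class V u2 (col u1 z)"
    by (auto simp: adj_def u color_class_def)
  then have "card {w. adj u w \<and> fst w = z} \<le> card ({z} \<times> color_class V u2 (col u1 z))"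
    by (intro card_mono) auto
  then show ?thesis using le by simp
next
  case True
  then show ?thesis by (metis card.empty le0)
qed

lemma finite_adj [simp]: "finite {w. adj u w}"
  by (rule finite_subset [of _ "V \<times> V"]) (use finite_V in \<open>auto simp: adj_def coords_subset_iff\<close>)

lemma card_adj_coord: "card {w. adj u w \<and> z \<in> coords w} \<le> 2 * M"
proof -
  have "{w. adj u w \<and> z \<in> coords w} \<subseteq>
      {w. adj u w \<and> fst w = z} \<union> prod.swap ` {w. adj (prod.swap u) w \<and> fst w = z}"
  proof (rule subrelI)
    fix w1 w2 assume "(w1, w2) \<in> {w. adj u w \<and> z \<in> coords w}"
    then have "adj u (w1, w2)" "adj (prod.swap u) (w2, w1)" "z = w1 \<or> z = w2"
      using adj_swap by (cases u; auto)+
    then show "(w1, w2) \<in> {w. adj u w \<and> fst w = z} \<union>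
        prod.swap ` {w. adj (prod.swap u) w \<and> fst w = z}"
      by force
  qed
  then have "card {w. adj u w \<and> z \<in> coords w} \<le>
      card ({w. adj u w \<and> fst w = z} \<union> prod.swap ` {w. adj (prod.swap u) w \<and> fst w = z})"
    by (intro card_mono) auto
  also have "\<dots> \<le> card {w. adj u w \<and> fst w = z} + card {w. adj (prod.swap u) w \<and> fst w = z}"
    using card_Un_le [of "{w. adj u w \<and> fst w = z}" "prod.swap ` {w. adj (prod.swap u) w \<and> fst w = z}"]
      card_image_le [of "{w. adj (prod.swap u) w \<and> fst w = z}" prod.swap] by simp
  also have "\<dots> \<le> 2 * M"
    using card_adj_fst [of u z] card_adj_fst [of "prod.swap u" z] by simp
  finally show ?thesis .
qed

lemma card_adj_meets:
  assumes "finite Z"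
  shows "card {w. adj u w \<and> coords w \<inter> Z \<noteq> {}} \<le> 2 * M * card Z"
proof -
  have "{w. adj u w \<and> coords w \<inter> Z \<noteq> {}} = (\<Union>z\<in>Z. {w. adj u w \<and> z \<in> coords w})" by auto
  also have "card \<dots> \<le> (\<Sum>z\<in>Z. card {w. adj u w \<and> z \<in> coords w})"
    by (rule card_UN_le [OF assms])
  also have "\<dots> \<le> (\<Sum>z\<in>Z. 2 * M)" by (intro sum_mono card_adj_coord)
  finally show ?thesis by (simp add: mult.commute)
qed

subsection \<open>Paths in the energy graph\<close>

text \<open>The index counts edges. Requiring \<open>clear\<close> for all pairs is stronger than
  distinctness of the energy vertices: no vertex of the original graph occurs in two of
  them.\<close>

definition paths :: "('v \<times> 'v) set \<Rightarrow> nat \<Rightarrow> 'v \<times> 'v \<Rightarrow> 'v \<times> 'v \<Rightarrow> ('v \<times> 'v) list set" where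
  "paths Q i x y = {xs. length xs = Suc i \<and> set xs \<subseteq> Q \<and> successively adj xs \<and> sorted_wrt clear xs \<and>
     hd xs = x \<and> last xs = y}"

lemma finite_paths: "finite Q \<Longrightarrow> finite (paths Q i x y)"
  by (rule finite_subset [OF _ finite_lists_length_eq [of Q "Suc i"]]) (auto simp: paths_def)

lemma paths_1: "card (paths Q (Suc 0) x y) \<le> 1"
proof -
  have "paths Q (Suc 0) x y \<subseteq> {[x, y]}"
    by (auto simp: paths_def length_Suc_conv)
  then have "card (paths Q (Suc 0) x y) \<le> card {[x, y]}" by (intro card_mono) auto
  then show ?thesis by simp
qed

lemma card_paths_through:
  assumes Q: "finite Q" and j: "j \<in> {1..<i}"
  shows "card {xs \<in> paths Q i x y. xs ! j = w} \<le> card (paths Q j x w) * card (paths Q (i - j) w y)"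
proof -
  let ?f = "\<lambda>xs. (take (Suc j) xs, drop j xs)"
  have "card {xs \<in> paths Q i x y. xs ! j = w} \<le> card (paths Q j x w \<times> paths Q (i - j) w y)"
  proof (rule card_inj_on_le)
    show "inj_on ?f {xs \<in> paths Q i x y. xs ! j = w}"
    proof (rule inj_onI)
      fix xs ys :: "('v \<times> 'v) list"
      assume "?f xs = ?f ys"
      \<comment> \<open>The two pieces share the vertex at position \<open>j\<close>, which is
        removed from the first before they are glued.\<close>
      then have "take j (take (Suc j) xs) @ drop j xs = take j (take (Suc j) ys) @ drop j ys" by simp
      then show "xs = ys" by (simp add: min_def)
    qed
    show "?f ` {xs \<in> paths Q i x y. xs ! j = w} \<subseteq> paths Q j x w \<times> paths Q (i - j) w y"
    proof clarify
      fix xs assume xs: "xs \<in> paths Q i x y" and w: "w = xs ! j"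
      then have len: "length xs = Suc i" by (simp add: paths_def)
      have "last (take (Suc j) xs) = xs ! j"
        using len j by (simp add: take_Suc_conv_app_nth)
      moreover have "hd (drop j xs) = xs ! j"
        using len j by (simp add: hd_drop_conv_nth)
      moreover have "last (drop j xs) = last xs"
        using len j by (simp add: last_drop)
      moreover have "hd (take (Suc j) xs) = hd xs" by (cases xs) auto
      moreover have "successively adj (take (Suc j) xs)" "successively adj (drop j xs)"
        using xs len j by (auto simp: paths_def successively_conv_nth)
      moreover have "set (take (Suc j) xs) \<subseteq> Q" "set (drop j xs) \<subseteq> Q"
        using xs set_take_subset [of "Suc j" xs] set_drop_subset [of j xs] by (auto simp: paths_def)
      ultimately show "take (Suc j) xs \<in> paths Q j x (xs ! j) \<and> drop j xs \<in> paths Q (i - j) (xs ! j) y"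
        using xs len j by (auto simp: paths_def sorted_wrt_take sorted_wrt_drop)
    qed
  qed (use Q finite_paths in auto)
  then show ?thesis by (simp add: card_cartesian_product)
qed

text \<open>At most \<open>s\<close> inner positions times the \<open>(2 * p)\<^sup>2\<close> pairs
  formed from at most \<open>2 * p\<close> used vertices.\<close>

definition K :: nat where "K = 4 * s * p\<^sup>2"

text \<open>An obstructed path passes at some inner position through one of the pairs over
  \<open>U\<close>. Splitting it there and applying the bounds for shorter lengths leaves at most
  \<open>K ^ (i - 2)\<close> paths for each choice, and the choices number at most
  \<open>K\<close>.\<close>

lemma card_obstructed:
  assumes Q: "finite Q" and U: "finite U" "card U \<le> 2 * p" and i: "2 \<le> i" "i \<le> s"
    and IH: "\<And>j x y. 1 \<le> j \<Longrightarrow> j < i \<Longrightarrow> card (paths Q j x y) \<le> K ^ (j - 1)"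
  shows "card {xs \<in> paths Q i x y. \<exists>j\<in>{1..<i}. coords (xs ! j) \<subseteq> U} \<le> K ^ (i - 1)"
proof -
  have *: "{xs \<in> P. \<exists>j\<in>J. xs ! j \<in> W} = (\<Union>j\<in>J. \<Union>w\<in>W. {xs \<in> P. xs ! j = w})" for P J and W :: "('v \<times> 'v) set"
    by blast
  have "{xs \<in> paths Q i x y. \<exists>j\<in>{1..<i}. coords (xs ! j) \<subseteq> U} =
      (\<Union>j\<in>{1..<i}. \<Union>w\<in>U \<times> U. {xs \<in> paths Q i x y. xs ! j = w})"
    unfolding coords_subset_iff by (rule *)
  also have "card \<dots> \<le> (\<Sum>j\<in>{1..<i}. card (\<Union>w\<in>U \<times> U. {xs \<in> paths Q i x y. xs ! j = w}))"
    by (rule card_UN_le) simp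
  also have "\<dots> \<le> (\<Sum>j\<in>{1..<i}. \<Sum>w\<in>U \<times> U. card {xs \<in> paths Q i x y. xs ! j = w})"
    using U by (intro sum_mono card_UN_le) simp
  also have "\<dots> \<le> (\<Sum>j\<in>{1..<i}. \<Sum>w\<in>U \<times> U. K ^ (i - 2))"
  proof (intro sum_mono)
    fix j w assume j: "j \<in> {1..<i}"
    have "card {xs \<in> paths Q i x y. xs ! j = w} \<le> card (paths Q j x w) * card (paths Q (i - j) w y)"
      by (rule card_paths_through [OF Q j])
    also have "\<dots> \<le> K ^ (j - 1) * K ^ (i - j - 1)"
      using j by (intro mult_mono IH) auto
    also have "\<dots> = K ^ (i - 2)"
      using j by (simp flip: power_add)
    finally show "card {xs \<in> paths Q i x y. xs ! j = w} \<le> K ^ (i - 2)" .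
  qed
  also have "\<dots> = (i - 1) * (card U * card U) * K ^ (i - 2)"
    by (simp add: card_cartesian_product)
  also have "\<dots> \<le> s * ((2 * p) * (2 * p)) * K ^ (i - 2)"
    using U i by (intro mult_mono) auto
  also have "s * ((2 * p) * (2 * p)) = K"
    by (simp add: K_def power2_eq_square)
  also have "K * K ^ (i - 2) = K ^ (i - 1)"
  proof -
    have "i - 1 = Suc (i - 2)" using i by simp
    then show ?thesis by simp
  qed
  finally show ?thesis .
qed

text \<open>The surplus \<open>r - (a + b)\<close> is unaffected by a pendant edge, so
  a configuration with surplus \<open>t - 2\<close> can be grown to \<open>a + b = p\<close>.\<close>

lemma pendant_growth:
  assumes Q: "Q \<subseteq> V \<times> V" "\<And>u. u \<in> Q \<Longrightarrow> card {w \<in> Q. adj u w} > (2 * p)\<^sup>2"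
    and "U \<subseteq> V" "repeats U r" "\<And>b. card (half b U) \<le> 2 * a b" "\<And>b. 2 * a b \<le> p"
    and "a True + a False + t \<le> r + 2"
    and "\<And>b. \<exists>u\<in>Q. pside u = b \<and> coords u \<subseteq> U"
  shows False
  using assms(3-)
proof (induction "p - a True - a False" arbitrary: U r a rule: less_induct)
  case less
  show False
  proof (cases "\<forall>b. 2 * a b = p")
    case True
    then have "a True + a False = p" by (metis mult_2 mult_left_cancel zero_neq_numeral)
    \<comment> \<open>At saturation the caps sum to \<open>p\<close>, and
      \<open>p + t = s * t + 2\<close>, so the surplus condition becomes
      \<open>s * t \<le> r\<close>.\<close>
    moreover have "s * t = (s - 1) * t + t" using s by (cases s) auto
    ultimately have "s * t \<le> r" using less.prems(5) p by simp
    moreover have "card (half b U) \<le> p" for b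
      using less.prems(3) [of b] True by simp
    ultimately show False
      using not_repeats_le less.prems(1,2) repeats_mono by blast
  next
    case False
    then obtain b where "2 * a b \<noteq> p" by blast
    then have b: "2 * a b < p" using less.prems(4) [of b] by simp
    obtain u where u: "u \<in> Q" "pside u = (\<not> b)" "coords u \<subseteq> U" using less.prems(6) by blast
    have U: "finite U" using less.prems(1) finite_V finite_subset by blast
    have half_le: "card (half c U) \<le> p" for c
      using less.prems(3,4) le_trans by blast
    have "card U \<le> 2 * p"
      using card_halves [OF U, of True] half_le [of True] half_le [of False] by simp
    then have "card (U \<times> U) \<le> (2 * p)\<^sup>2"
      by (simp only: card_cartesian_product power2_eq_square mult_le_mono)
    then have "card (U \<times> U) < card {w \<in> Q. adj u w}"
      using Q(2) [OF u(1)] by linarith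
    \<comment> \<open>The degree of \<open>u\<close> exceeds the number of pairs over
      \<open>U\<close>, so some neighbour has a new coordinate. It lies on side \<open>b\<close>
      because \<open>u\<close> was chosen on the other side.\<close>
    then have "\<not> {w \<in> Q. adj u w} \<subseteq> U \<times> U"
      using U card_mono [of "U \<times> U" "{w \<in> Q. adj u w}"] by auto
    then obtain w where w: "w \<in> Q" "adj u w" "\<not> coords w \<subseteq> U"
      by (auto simp: coords_subset_iff)
    then have m: "matched w u" by (simp add: adj_def matched_sym)
    then have side_w: "pside w = b" using pside_matched u by blast
    define a' where "a' = a(b := Suc (a b))"
    \<comment> \<open>By parity, \<open>2 * a b < p\<close> leaves room to raise the cap by a full
      2.\<close>
    have even_p: "even p" using s p by simp
    show False
    proof (rule less.hyps [of a' "U \<union> coords w" "Suc r"])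
      show "p - a' True - a' False < p - a True - a False"
        using b less.prems(4) [of True] less.prems(4) [of False]
        by (cases b) (auto simp: a'_def)
      show "U \<union> coords w \<subseteq> V" using less.prems(1) w by (auto simp: adj_def)
      show "repeats (U \<union> coords w) (Suc r)"
        using repeats_Un_pendant [OF U less.prems(2) w(3) m u(3)] .
      show "card (half c (U \<union> coords w)) \<le> 2 * a' c" for c
      proof -
        have "card (half c (coords w)) \<le> 2 * of_bool (b = c)"
          using card_half_coords [OF m, of c] side_w by simp
        moreover have "card (half c (U \<union> coords w)) \<le> card (half c U) + card (half c (coords w))"
          by (simp add: half_Un card_Un_le)
        ultimately show ?thesis
          using less.prems(3) [of c] by (auto simp: a'_def split: if_splits)
      qed
      show "2 * a' c \<le> p" for c
        using b even_p less.prems(4) [of c] by (auto simp: a'_def elim!: evenE)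
      show "a' True + a' False + t \<le> Suc r + 2"
        using less.prems(5) by (cases b) (auto simp: a'_def)
      show "\<exists>u\<in>Q. pside u = c \<and> coords u \<subseteq> U \<union> coords w" for c
        using less.prems(6) [of c] by blast
    qed
  qed
qed

text \<open>Strong induction on \<open>i\<close>. With more than \<open>K ^ (i - 1)\<close> paths,
  \<open>card_obstructed\<close> supplies, \<open>t\<close> times in succession, a path all of whose
  inner vertices bring a new coordinate. The resulting configuration has \<open>t * i\<close>
  repetitions, and \<open>pendant_growth\<close> refutes it.\<close>

lemma card_paths_le:
  assumes Q: "Q \<subseteq> V \<times> V" "\<And>u. u \<in> Q \<Longrightarrow> card {w \<in> Q. adj u w} > (2 * p)\<^sup>2"
    and i: "1 \<le> i" "i \<le> s"
  shows "card (paths Q i x y) \<le> K ^ (i - 1)"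
  using i
proof (induction i arbitrary: x y rule: less_induct)
  case (less i)
  show ?case
  proof (cases "i = 1")
    case True
    then show ?thesis using paths_1 by simp
  next
    case False
    then have i: "2 \<le> i" "i \<le> s" using less.prems by auto
    have IH: "card (paths Q j x y) \<le> K ^ (j - 1)" if "1 \<le> j" "j < i" for j x y
      using less.IH [of j x y] that i by simp
    have finQ: "finite Q" using Q(1) finite_V finite_subset by blast
    show ?thesis
    proof (rule ccontr)
      assume "\<not> ?thesis"
      then have many: "K ^ (i - 1) < card (paths Q i x y)" by simp
      have path: "length xs = Suc i" "set xs \<subseteq> Q" "successively matched xs" "sorted_wrt clear xs"
          "hd xs = x" "last xs = y" if "xs \<in> paths Q i x y" for xs
        using that by (auto simp: paths_def adj_def intro: successively_mono)
      have nth_ends: "xs ! 0 = x" "xs ! i = y" if "xs \<in> paths Q i x y" for xs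
        using path [OF that] by (cases xs; auto simp: last_conv_nth)+
      have "paths Q i x y \<noteq> {}" using many by auto
      then obtain xs0 where xs0: "xs0 \<in> paths Q i x y" by auto
      have pside_y: "pside y = (pside x = even i)"
        using pside_nth [of xs0 i] path [OF xs0] nth_ends [OF xs0] by simp
      have "xs0 ! 0 \<in> Q" "xs0 ! i \<in> Q"
        using path(1,2) [OF xs0] by (auto intro!: nth_mem [THEN subsetD [rotated]])
      then have xyQ: "x \<in> Q" "y \<in> Q" using nth_ends [OF xs0] by auto
      have matched_ends: "\<exists>v. matched x v" "\<exists>v. matched y v"
      proof -
        have "matched (xs0 ! j) (xs0 ! Suc j)" if "j < i" for j
          using path(1,3) [OF xs0] that by (auto simp: successively_conv_nth)
        from this [of 0] this [of "i - 1"]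
        have "matched x (xs0 ! Suc 0)" "matched (xs0 ! (i - 1)) y"
          using i nth_ends [OF xs0] by auto
        then show "\<exists>v. matched x v" "\<exists>v. matched y v"
          using matched_sym by blast+
      qed
      \<comment> \<open>For side \<open>b\<close>, \<open>base b\<close> counts the ends and
        \<open>cnt b\<close> the inner positions of one path; \<open>a m b\<close> thus caps the
        number of energy vertices on side \<open>b\<close> after \<open>m\<close> paths.\<close>
      define base where "base b = of_bool (pside x = b) + (of_bool (pside y = b) :: nat)" for b
      define cnt where "cnt b = (if b = pside x then (i - 1) div 2 else i div 2)" for b
      define a where "a m b = base b + m * cnt b" for m b
      have a_le: "2 * a m b \<le> p" if "m \<le> t" for m b
      proof -
        obtain q where q: "s = 2 * q + 1" using s(2) by (elim oddE)
        then have p': "p = 2 * (q * t + 1)" by (simp add: p)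
        have "a m b \<le> q * t + 1"
        proof (cases "even i")
          case True
          then obtain k where k: "i = 2 * k" by auto
          \<comment> \<open>For even \<open>i\<close> both ends are on one side, but that side has
            only \<open>k - 1\<close> inner positions per path. Replacing \<open>k\<close> by
            \<open>k - 1\<close> saves \<open>t \<ge> 2\<close>, enough for the two ends.\<close>
          have "k \<ge> 1" "k \<le> q" using i q k by auto
          then have "m * k \<le> t * q" "m * (k - 1) + t \<le> t * (q - 1) + t"
            using that by (auto intro: mult_mono)
          moreover have "t * (q - 1) + t = t * q" using \<open>k \<ge> 1\<close> \<open>k \<le> q\<close> by (cases q) auto
          moreover have "(i - 1) div 2 = k - 1" "i div 2 = k" using k by auto
          ultimately show ?thesis
            using t pside_y True by (auto simp: a_def base_def cnt_def mult.commute)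
        next
          case False
          then obtain k where k: "i = 2 * k + 1" by (elim oddE)
          then have "m * k \<le> t * q" using i q that by (intro mult_mono) auto
          then show ?thesis
            using pside_y k by (auto simp: a_def base_def cnt_def mult.commute)
        qed
        then show ?thesis using p' by simp
      qed
      have a_sum: "a m True + a m False = 2 + m * (i - 1)" for m
      proof -
        have "(i - 1) div 2 + i div 2 = i - 1" using i by linarith
        then have "m * ((i - 1) div 2) + m * (i div 2) = m * (i - 1)" by (simp flip: add_mult_distrib2)
        then show ?thesis by (cases "pside x") (auto simp: a_def base_def cnt_def)
      qed
      \<comment> \<open>The last clause supplies an energy vertex opposite to \<open>x\<close>:
        pendant edges must be attached on both sides, whereas \<open>x\<close> and \<open>y\<close>
        share a side when \<open>i\<close> is even.\<close>
      have "\<exists>U \<subseteq> V. coords x \<subseteq> U \<and> coords y \<subseteq> U \<and> repeats U (m * i) \<and>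
          (\<forall>b. card (half b U) \<le> 2 * a m b) \<and>
          (m > 0 \<longrightarrow> (\<exists>u\<in>Q. pside u = (\<not> pside x) \<and> coords u \<subseteq> U))" if "m \<le> t" for m
        using that
      proof (induction m)
        case 0
        have "card (half b (coords x \<union> coords y)) \<le> 2 * a 0 b" for b
        proof -
          have "card (half b (coords x)) \<le> 2 * of_bool (pside x = b)"
            "card (half b (coords y)) \<le> 2 * of_bool (pside y = b)"
            using matched_ends card_half_coords by blast+
          then show ?thesis
            using card_Un_le [of "half b (coords x)" "half b (coords y)"]
            by (simp add: a_def base_def half_Un)
        qed
        then show ?case
          using xyQ Q(1) by (intro exI [of _ "coords x \<union> coords y"]) (auto simp: coords_subset_iff repeats_0)
      next
        case (Suc m)
        then obtain U where U: "U \<subseteq> V" "coords x \<subseteq> U" "coords y \<subseteq> U" "repeats U (m * i)"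
          "\<And>b. card (half b U) \<le> 2 * a m b" by auto
        have finU: "finite U" using U(1) finite_V finite_subset by blast
        have "card (half b U) \<le> p" for b
          using U(5) [of b] a_le [of m b] Suc.prems by simp
        then have "card U \<le> 2 * p"
          using card_halves [OF finU, of True] by (metis add_mono mult_2)
        then have "card {xs \<in> paths Q i x y. \<exists>j\<in>{1..<i}. coords (xs ! j) \<subseteq> U} < card (paths Q i x y)"
          using card_obstructed [OF finQ finU _ i IH, of x y] many by simp
        then have "{xs \<in> paths Q i x y. \<exists>j\<in>{1..<i}. coords (xs ! j) \<subseteq> U} \<noteq> paths Q i x y"
          by (metis less_irrefl)
        then obtain xs where xs: "xs \<in> paths Q i x y" "\<forall>j\<in>{1..<i}. \<not> coords (xs ! j) \<subseteq> U"
          by blast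
        define X where "X = U \<union> (\<Union>j\<in>{1..<i}. coords (xs ! j))"
        have "repeats X (m * i + i)"
          and half_X: "card (half b X) \<le> card (half b U) + 2 * (if b = pside (hd xs) then (i - 1) div 2 else i div 2)" for b
          unfolding X_def using repeats_Un_full_path [of U "m * i" xs i] finU U xs path [OF xs(1)] i by auto
        moreover have "card (half b X) \<le> 2 * a (Suc m) b" for b
          using half_X [of b] U(5) [of b] path(5) [OF xs(1)] by (simp add: a_def cnt_def)
        moreover have inQ: "xs ! j \<in> Q" if "j < Suc i" for j
          using path(1,2) [OF xs(1)] that by auto
        then have "coords (xs ! j) \<subseteq> V" if "j < Suc i" for j
          using Q(1) that by (auto simp: coords_subset_iff)
        then have "X \<subseteq> V" using U(1) by (simp add: X_def UN_subset_iff)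
        moreover have "pside (xs ! 1) = (\<not> pside x)"
          using pside_nth [of xs 1] path [OF xs(1)] nth_ends [OF xs(1)] i by simp
        moreover have "coords (xs ! 1) \<subseteq> X" using i by (auto simp: X_def)
        ultimately show ?case
          using U(2,3) inQ [of 1] i by (intro exI [of _ X]) (auto simp: add.commute X_def)
      qed
      from this [of t] obtain U where U: "U \<subseteq> V" "coords x \<subseteq> U" "repeats U (t * i)"
        "\<And>b. card (half b U) \<le> 2 * a t b" "\<exists>u\<in>Q. pside u = (\<not> pside x) \<and> coords u \<subseteq> U"
        using t by auto
      show False
      proof (rule pendant_growth [OF Q U(1,3,4)])
        show "2 * a t b \<le> p" for b by (rule a_le) simp
        \<comment> \<open>Together with \<open>a_sum\<close>, the surplus condition holds with
          equality.\<close>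
        have "t * (i - 1) + t = t * i" using i by (cases i) auto
        then show "a t True + a t False + t \<le> t * i + 2" by (simp add: a_sum)
        show "\<exists>u\<in>Q. pside u = b \<and> coords u \<subseteq> U" for b
          using U(2,5) xyQ by (cases "b = pside x") auto
      qed
    qed
  qed
qed

section \<open>Lower bound on the number of paths and the resulting degree bound\<close>

definition paths_to :: "('v \<times> 'v) set \<Rightarrow> nat \<Rightarrow> 'v \<times> 'v \<Rightarrow> ('v \<times> 'v) list set" where
  "paths_to Q m y = {xs. length xs = Suc m \<and> set xs \<subseteq> Q \<and> successively adj xs \<and> sorted_wrt clear xs \<and>
     last xs = y}"

lemma finite_paths_to: "finite Q \<Longrightarrow> finite (paths_to Q i y)"
  by (rule finite_subset [OF _ finite_lists_length_eq [of Q "Suc i"]]) (auto simp: paths_to_def)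

text \<open>A path is extended at its head by a neighbour sharing no coordinate with it. At most
  \<open>2 * s\<close> vertices are in use, each lying in at most \<open>2 * M\<close> neighbours of
  the head, so at most \<open>4 * M * s\<close> neighbours are lost.\<close>

lemma card_paths_to_ge:
  assumes Q: "finite Q" "\<And>u. u \<in> Q \<Longrightarrow> d \<le> card {w \<in> Q. adj u w}" and "y \<in> Q" "m \<le> s"
  shows "(d - 4 * M * s) ^ m \<le> card (paths_to Q m y)"
  using \<open>m \<le> s\<close>
proof (induction m)
  case 0
  have "[y] \<in> paths_to Q 0 y" using \<open>y \<in> Q\<close> by (auto simp: paths_to_def)
  then have "card (paths_to Q 0 y) > 0"
    using finite_paths_to [OF Q(1)] card_gt_0_iff by blast
  then show ?case by simp
next
  case (Suc m)
  define ext where "ext xs = {w \<in> Q. adj (hd xs) w} - {w. adj (hd xs) w \<and> coords w \<inter> \<Union> (coords ` set xs) \<noteq> {}}" for xs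
  have fin: "finite (ext xs)" for xs using Q(1) by (auto simp: ext_def)
  have ext: "d - 4 * M * s \<le> card (ext xs)" if xs: "xs \<in> paths_to Q m y" for xs
  proof -
    let ?Z = "\<Union> (coords ` set xs)"
    have "card ?Z \<le> (\<Sum>v\<in>set xs. card (coords v))" by (rule card_UN_le) simp
    also have "\<dots> \<le> (\<Sum>v\<in>set xs. 2)" by (intro sum_mono card_coords_le)
    also have "\<dots> \<le> 2 * s"
      using xs Suc.prems card_length [of xs] by (simp add: paths_to_def)
    finally have "2 * M * card ?Z \<le> 2 * M * (2 * s)" by (rule mult_le_mono2)
    moreover have "card {w. adj (hd xs) w \<and> coords w \<inter> ?Z \<noteq> {}} \<le> 2 * M * card ?Z"
      by (rule card_adj_meets) simp
    ultimately have "card {w. adj (hd xs) w \<and> coords w \<inter> ?Z \<noteq> {}} \<le> 4 * M * s" by linarith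
    moreover have "hd xs \<in> Q" using xs by (cases xs) (auto simp: paths_to_def)
    then have "d \<le> card {w \<in> Q. adj (hd xs) w}" by (rule Q(2))
    moreover have "card {w \<in> Q. adj (hd xs) w} - card {w. adj (hd xs) w \<and> coords w \<inter> ?Z \<noteq> {}} \<le> card (ext xs)"
      unfolding ext_def by (rule diff_card_le_card_Diff) (auto intro: finite_subset [OF _ finite_adj])
    ultimately show ?thesis by linarith
  qed
  have "(d - 4 * M * s) ^ Suc m \<le> (\<Sum>xs\<in>paths_to Q m y. d - 4 * M * s)"
    using Suc by (simp add: mult.commute)
  also have "\<dots> \<le> (\<Sum>xs\<in>paths_to Q m y. card (ext xs))"
    by (intro sum_mono ext)
  also have "\<dots> = card (Sigma (paths_to Q m y) ext)"
    using fin finite_paths_to [OF Q(1)] by (intro card_SigmaI [symmetric]) auto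
  also have "\<dots> \<le> card (paths_to Q (Suc m) y)"
  proof (rule card_inj_on_le)
    show "inj_on (\<lambda>(xs, w). w # xs) (Sigma (paths_to Q m y) ext)" by (auto simp: inj_on_def)
    show "(\<lambda>(xs, w). w # xs) ` Sigma (paths_to Q m y) ext \<subseteq> paths_to Q (Suc m) y"
    proof clarify
      fix xs w1 w2 assume xs: "xs \<in> paths_to Q m y" and w: "(w1, w2) \<in> ext xs"
      then have "adj (w1, w2) (hd xs)" "xs \<noteq> []"
        by (auto simp: ext_def adj_sym paths_to_def)
      moreover have "clear (w1, w2) v" if "v \<in> set xs" for v
        using w that by (auto simp: ext_def clear_def)
      ultimately show "(w1, w2) # xs \<in> paths_to Q (Suc m) y"
        using xs w by (auto simp: paths_to_def successively_Cons ext_def)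
    qed
  qed (rule finite_paths_to [OF Q(1)])
  finally show ?case .
qed

text \<open>Diagonal pairs are kept to make the count exact; they are isolated, since
  \<open>matched\<close> requires distinct coordinates.\<close>

definition energy_vertices :: "('v \<times> 'v) set" where
  "energy_vertices = half True V \<times> half True V \<union> half False V \<times> half False V"

lemma finite_energy_vertices: "finite energy_vertices"
  using finite_V by (simp add: energy_vertices_def)

lemma card_energy_vertices: "card energy_vertices = 2 * n\<^sup>2"
proof -
  have "half True V \<times> half True V \<inter> half False V \<times> half False V = {}" by (auto simp: half_def)
  then show ?thesis
    unfolding energy_vertices_def using finite_V
    by (simp add: card_Un_disjoint card_cartesian_product card_half_V power2_eq_square)
qed

text \<open>Paths of length \<open>s\<close> ending at a fixed \<open>y\<close> are counted twice:
  from below by greedy extension, from above by \<open>card_paths_le\<close> summed over the at most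
  \<open>2 * n\<^sup>2\<close> starting points.\<close>

lemma min_degree_le:
  assumes Q: "Q \<subseteq> energy_vertices" "Q \<noteq> {}" "\<And>u. u \<in> Q \<Longrightarrow> d \<le> card {w \<in> Q. adj u w}"
    and d: "(2 * p)\<^sup>2 < d"
  shows "(d - 4 * M * s) ^ s \<le> 2 * n\<^sup>2 * K ^ (s - 1)"
proof -
  have finQ: "finite Q" using Q(1) finite_energy_vertices finite_subset by blast
  obtain y where y: "y \<in> Q" using Q(2) by blast
  have QV: "Q \<subseteq> V \<times> V" using Q(1) half_subset by (fastforce simp: energy_vertices_def)
  have deg: "(2 * p)\<^sup>2 < card {w \<in> Q. adj u w}" if "u \<in> Q" for u
    using Q(3) [OF that] d by simp
  have "paths_to Q s y \<subseteq> (\<Union>x\<in>Q. paths Q s x y)"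
  proof
    fix xs assume xs: "xs \<in> paths_to Q s y"
    then have "hd xs \<in> Q" by (cases xs) (auto simp: paths_to_def)
    then show "xs \<in> (\<Union>x\<in>Q. paths Q s x y)" using xs by (auto simp: paths_to_def paths_def)
  qed
  then have "card (paths_to Q s y) \<le> card (\<Union>x\<in>Q. paths Q s x y)"
    using finQ finite_paths by (intro card_mono) auto
  also have "\<dots> \<le> (\<Sum>x\<in>Q. card (paths Q s x y))" by (rule card_UN_le [OF finQ])
  also have "\<dots> \<le> (\<Sum>x\<in>Q. K ^ (s - 1))"
    using s by (intro sum_mono card_paths_le [OF QV deg]) auto
  also have "\<dots> \<le> 2 * n\<^sup>2 * K ^ (s - 1)"
    using card_mono [OF finite_energy_vertices Q(1)] by (simp add: card_energy_vertices)
  finally show ?thesis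
    using card_paths_to_ge [OF finQ Q(3) y, of s] by simp
qed

subsection \<open>Edges of the energy graph\<close>

definition same_colored :: "(('v \<times> 'v) \<times> ('v \<times> 'v)) set" where
  "same_colored = {(e, f) \<in> light_edges \<times> light_edges. case_prod col e = case_prod col f}"

lemma finite_light_edges: "finite light_edges"
  using finite_V by (auto simp: light_edges_def intro: finite_subset [of _ "cross V"])

lemma card_light_edges_le: "card light_edges \<le> n\<^sup>2"
proof -
  have "card light_edges \<le> card (cross V)"
    using finite_V by (intro card_mono) (auto simp: light_edges_def)
  then show ?thesis by (simp add: cross_def card_cartesian_product card_half_V power2_eq_square)
qed

text \<open>Cauchy-Schwarz for the sizes of the color classes of light edges, whose squares sum to
  \<open>card same_colored\<close>.\<close>

lemma card_same_colored:
  assumes "finite C" "colors V \<subseteq> C"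
  shows "(card light_edges)\<^sup>2 \<le> card C * card same_colored"
proof -
  define L where "L k = {e \<in> light_edges. case_prod col e = k}" for k
  have fin: "finite (L k)" for k using finite_light_edges by (simp add: L_def)
  have "case_prod col e \<in> C" if "e \<in> light_edges" for e
    using that assms(2) by (auto simp: light_edges_def colors_def)
  then have "light_edges = (\<Union>k\<in>C. L k)" "same_colored = (\<Union>k\<in>C. L k \<times> L k)"
    by (auto simp: L_def same_colored_def)
  moreover have "card (\<Union>k\<in>C. L k) = (\<Sum>k\<in>C. card (L k))"
    using assms fin by (intro card_UN_disjoint) (auto simp: L_def)
  moreover have "card (\<Union>k\<in>C. L k \<times> L k) = (\<Sum>k\<in>C. card (L k \<times> L k))"
    using assms fin by (intro card_UN_disjoint) (auto simp: L_def)
  ultimately have *: "card light_edges = (\<Sum>k\<in>C. card (L k))" "card same_colored = (\<Sum>k\<in>C. (card (L k))\<^sup>2)"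
    by (simp_all add: card_cartesian_product power2_eq_square)
  have "(\<Sum>k\<in>C. real (card (L k)))\<^sup>2 \<le> (\<Sum>k\<in>C. (real (card (L k)))\<^sup>2) * card C"
    by (rule sum_squared_le_sum_of_squares)
  then have "real ((card light_edges)\<^sup>2) \<le> real (card C * card same_colored)"
    by (simp add: * mult.commute)
  then show ?thesis by (simp only: of_nat_le_iff)
qed

text \<open>Serves to count pairs of equally colored light edges with a common endpoint
  \<open>v f\<close>: the partner is recovered by \<open>h f\<close> from its other endpoint, which
  ranges over a color class of size at most \<open>M\<close>. It is applied once for each
  side.\<close>

lemma card_same_endpoint:
  assumes "\<And>f. f \<in> light_edges \<Longrightarrow> D f \<subseteq> h f ` color_class V (v f) (case_prod col f)"
    and "\<And>f. f \<in> light_edges \<Longrightarrow> card (color_class V (v f) (case_prod col f)) \<le> M"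
  shows "card (Sigma light_edges D) \<le> M * card light_edges"
proof -
  have D: "finite (D f) \<and> card (D f) \<le> M" if "f \<in> light_edges" for f
    using assms [OF that] surj_card_le [of "color_class V (v f) (case_prod col f)"]
    by (meson finite_color_class finite_imageI finite_subset le_trans)
  then have "card (Sigma light_edges D) = (\<Sum>f\<in>light_edges. card (D f))"
    using finite_light_edges by (intro card_SigmaI) auto
  also have "\<dots> \<le> (\<Sum>f\<in>light_edges. M)" by (intro sum_mono) (simp add: D)
  finally show ?thesis by (simp add: mult.commute)
qed

text \<open>Regrouping two equally colored edges by sides, the map \<open>g\<close>, turns a pair
  without common endpoints into an energy edge that starts on the \<open>True\<close> side. Reversal
  gives a second, disjoint family, hence the factor 2; pairs with a common endpoint make up the
  error term.\<close>

lemma card_energy_edges: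
  "2 * card same_colored \<le> card {(u, w) \<in> energy_vertices \<times> energy_vertices. adj u w} + 4 * M * card light_edges"
proof -
  define E where "E = {(u, w) \<in> energy_vertices \<times> energy_vertices. adj u w}"
  define D where "D = {(e, f) \<in> same_colored. fst e \<noteq> fst f \<and> snd e \<noteq> snd f}"
  define A where "A = Sigma light_edges (\<lambda>e. {f \<in> light_edges. case_prod col e = case_prod col f \<and> fst e = fst f})"
  define B where "B = Sigma light_edges (\<lambda>e. {f \<in> light_edges. case_prod col e = case_prod col f \<and> snd e = snd f})"
  define g where "g = (\<lambda>((a, b), (a', b')). ((a, a'), (b, b')) :: ('v \<times> 'v) \<times> ('v \<times> 'v))"
  have finE: "finite E"
    using finite_energy_vertices by (auto simp: E_def intro: finite_subset [of _ "energy_vertices \<times> energy_vertices"])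
  have finD: "finite D" "finite A" "finite B"
    using finite_light_edges
    by (auto simp: D_def A_def B_def same_colored_def intro: finite_subset [of _ "light_edges \<times> light_edges"])
  have A: "card A \<le> M * card light_edges"
    unfolding A_def
  proof (rule card_same_endpoint [where v = fst and h = "\<lambda>e b. (fst e, b)"])
    fix e assume e: "e \<in> light_edges"
    show "{f \<in> light_edges. case_prod col e = case_prod col f \<and> fst e = fst f} \<subseteq>
        Pair (fst e) ` color_class V (fst e) (case_prod col e)"
      by (auto simp: light_edges_def cross_def half_def color_class_def)
    show "card (color_class V (fst e) (case_prod col e)) \<le> M"
      using e by (auto simp: light_edges_def light_def)
  qed
  have B: "card B \<le> M * card light_edges"
    unfolding B_def
  proof (rule card_same_endpoint [where v = snd and h = "\<lambda>e a. (a, snd e)"])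
    fix e assume e: "e \<in> light_edges"
    show "{f \<in> light_edges. case_prod col e = case_prod col f \<and> snd e = snd f} \<subseteq>
        (\<lambda>a. (a, snd e)) ` color_class V (snd e) (case_prod col e)"
    proof
      fix f assume f: "f \<in> {f \<in> light_edges. case_prod col e = case_prod col f \<and> snd e = snd f}"
      then have "fst f \<in> color_class V (snd e) (case_prod col e)"
        using col_commute [of "fst f" "snd f"]
        by (auto simp: light_edges_def cross_def half_def color_class_def case_prod_beta)
      then show "f \<in> (\<lambda>a. (a, snd e)) ` color_class V (snd e) (case_prod col e)"
        using f by (intro image_eqI [of _ _ "fst f"]) auto
    qed
    show "card (color_class V (snd e) (case_prod col e)) \<le> M"
      using e by (auto simp: light_edges_def light_def)
  qed
  have "same_colored \<subseteq> D \<union> (A \<union> B)"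
    by (auto simp: same_colored_def D_def A_def B_def)
  then have "card same_colored \<le> card (D \<union> (A \<union> B))"
    using finD by (intro card_mono) auto
  also have "\<dots> \<le> card D + (card A + card B)"
    by (meson add_left_mono card_Un_le le_trans)
  finally have S: "card same_colored \<le> card D + 2 * M * card light_edges"
    using A B by linarith
  have g_E: "g ` D \<subseteq> E \<inter> Collect (pside \<circ> fst)"
    by (auto simp: g_def D_def E_def same_colored_def light_edges_def cross_def half_def
        energy_vertices_def adj_def pside_def)
  have swap_E: "prod.swap ` g ` D \<subseteq> E - Collect (pside \<circ> fst)"
  proof -
    have "(w, u) \<in> E \<and> \<not> pside w" if "(u, w) \<in> g ` D" for u w
    proof -
      have "(u, w) \<in> E \<inter> Collect (pside \<circ> fst)" using that g_E by blast
      then have "(u, w) \<in> E" "pside u" by auto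
      moreover from this have "pside w = (\<not> pside u)"
        by (intro pside_matched) (auto simp: E_def adj_def)
      ultimately show ?thesis using adj_sym by (auto simp: E_def)
    qed
    then show ?thesis
      by (intro image_subsetI) (metis (no_types, lifting) Diff_iff comp_apply fst_conv mem_Collect_eq surj_pair swap_simp)
  qed
  have inj: "inj_on g D" by (auto simp: g_def inj_on_def)
  have "card D + card D = card (g ` D) + card (prod.swap ` g ` D)"
    by (simp add: card_image inj)
  also have "\<dots> = card (g ` D \<union> prod.swap ` g ` D)"
    using finD g_E swap_E by (intro card_Un_disjoint [symmetric]) blast+
  also have "\<dots> \<le> card E"
    using g_E swap_E finE by (intro card_mono) auto
  finally show ?thesis using S by (simp add: E_def)
qed

text \<open>By \<open>min_degree_le\<close> the energy graph has no subgraph of minimum degree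
  \<open>d\<close>, so it is sparse and few pairs of light edges share a color. Cauchy-Schwarz and
  the at least \<open>n\<^sup>2 / 2\<close> light edges then force many colors.\<close>

theorem color_count:
  assumes C: "finite C" "colors V \<subseteq> C"
    and d: "(2 * p)\<^sup>2 < d" "2 * n\<^sup>2 * K ^ (s - 1) < (d - 4 * M * s) ^ s"
  shows "n\<^sup>2 \<le> 8 * card C * (d + M)"
proof -
  let ?E = "{(u, w) \<in> energy_vertices \<times> energy_vertices. adj u w}"
  have "\<not> 2 * d * card energy_vertices < card ?E"
  proof
    assume "2 * d * card energy_vertices < card ?E"
    then obtain Q where "Q \<subseteq> energy_vertices" "Q \<noteq> {}" "\<forall>u\<in>Q. d \<le> card {w \<in> Q. adj u w}"
      using min_degree_subgraph [OF finite_energy_vertices, of adj d] adj_sym by blast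
    then show False using min_degree_le [of Q d] d by simp
  qed
  then have "card same_colored \<le> 2 * d * n\<^sup>2 + 2 * M * card light_edges"
    using card_energy_edges by (simp add: card_energy_vertices)
  also have "\<dots> \<le> 2 * d * n\<^sup>2 + 2 * M * n\<^sup>2"
    using card_light_edges_le by simp
  finally have *: "card same_colored \<le> 2 * (d + M) * n\<^sup>2" by (simp add: algebra_simps)
  have "(n\<^sup>2)\<^sup>2 \<le> (2 * card light_edges)\<^sup>2" using card_light_edges by (rule power_mono) simp
  also have "\<dots> = 4 * (card light_edges)\<^sup>2" by (simp add: power_mult_distrib)
  also have "\<dots> \<le> 4 * (card C * card same_colored)"
    using card_same_colored [OF C] by simp
  also have "\<dots> \<le> 4 * (card C * (2 * (d + M) * n\<^sup>2))"
    using * by (intro mult_le_mono2)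
  finally have "n\<^sup>2 * n\<^sup>2 \<le> n\<^sup>2 * (8 * card C * (d + M))"
    by (simp add: power2_eq_square algebra_simps)
  moreover have "0 < n\<^sup>2" using n p by simp
  ultimately show ?thesis by (metis mult_le_cancel1)
qed

end

subsection \<open>The Ramsey number\<close>

lemma edges_complete_bipartite:
  "edges (complete_bipartite m n) = (\<lambda>(i, j). {Inl i, Inr j}) ` ({..<m} \<times> {..<n})"
  by (auto simp: complete_bipartite_def)

lemma card_edges_complete_bipartite: "card (edges (complete_bipartite m n)) = m * n"
proof -
  have "inj_on (\<lambda>(i, j). {Inl i, Inr j} :: (nat + nat) set) ({..<m} \<times> {..<n})"
    by (auto simp: inj_on_def doubleton_eq_iff)
  then show ?thesis
    by (simp add: edges_complete_bipartite card_image card_cartesian_product)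
qed

lemma isomorphic_complete_bipartite:
  fixes U :: "(nat + nat) set"
  assumes "finite U" "card {v \<in> U. isl v} = p" "card {v \<in> U. \<not> isl v} = p"
  shows "isomorphic \<lparr>verts = U, edges = (\<lambda>(a, b). {a, b}) ` ({v \<in> U. isl v} \<times> {v \<in> U. \<not> isl v})\<rparr>
    (complete_bipartite p p)"
proof -
  obtain f where f: "bij_betw f {v \<in> U. isl v} {..<p}"
    using ex_bij_betw_finite_nat [of "{v \<in> U. isl v}"] assms by (auto simp: lessThan_atLeast0)
  obtain g where g: "bij_betw g {v \<in> U. \<not> isl v} {..<p}"
    using ex_bij_betw_finite_nat [of "{v \<in> U. \<not> isl v}"] assms by (auto simp: lessThan_atLeast0)
  define h where "h v = (if isl v then Inl (f v) else Inr (g v))" for v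
  have "bij_betw h ({v \<in> U. isl v} \<union> {v \<in> U. \<not> isl v}) (Inl ` {..<p} \<union> Inr ` {..<p})"
  proof (rule bij_betw_combine)
    have "bij_betw (Inl \<circ> f) {v \<in> U. isl v} (Inl ` {..<p})"
      using f by (rule bij_betw_trans) (simp add: bij_betw_def)
    then show "bij_betw h {v \<in> U. isl v} (Inl ` {..<p})"
      by (rule bij_betw_cong [THEN iffD1, rotated]) (simp add: h_def)
    have "bij_betw (Inr \<circ> g) {v \<in> U. \<not> isl v} (Inr ` {..<p})"
      using g by (rule bij_betw_trans) (simp add: bij_betw_def)
    then show "bij_betw h {v \<in> U. \<not> isl v} (Inr ` {..<p})"
      by (rule bij_betw_cong [THEN iffD1, rotated]) (simp add: h_def)
  qed auto
  moreover have "{v \<in> U. isl v} \<union> {v \<in> U. \<not> isl v} = U" by auto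
  ultimately have bij: "bij_betw h U ({..<p} <+> {..<p})" by (simp add: Plus_def)
  have "(\<lambda>e. h ` e) ` (\<lambda>(a, b). {a, b}) ` ({v \<in> U. isl v} \<times> {v \<in> U. \<not> isl v}) =
      (\<lambda>(i, j). {Inl i, Inr j}) ` (\<lambda>(a, b). (f a, g b)) ` ({v \<in> U. isl v} \<times> {v \<in> U. \<not> isl v})"
    unfolding image_image by (rule image_cong) (auto simp: h_def)
  also have "(\<lambda>(a, b). (f a, g b)) ` ({v \<in> U. isl v} \<times> {v \<in> U. \<not> isl v}) = {..<p} \<times> {..<p}"
    using map_prod_surj_on [OF bij_betw_imp_surj_on [OF f] bij_betw_imp_surj_on [OF g]]
    by (simp add: map_prod_def)
  finally show ?thesis
    using bij unfolding isomorphic_def edges_complete_bipartite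
    by (intro exI [of _ h]) (simp add: complete_bipartite_def)
qed

text \<open>An optimal coloring instantiates \<open>few_repeats\<close>: a set with halves of size
  \<open>p\<close> and \<open>s * t\<close> repetitions would span a K_{p,p} with fewer than
  \<open>q\<close> colors. The numerical conditions are those of \<open>color_count\<close> with
  \<open>M\<close> and \<open>K\<close> unfolded.\<close>

lemma ramsey_lower_bound:
  fixes s t p n :: nat
  assumes t: "t \<ge> 2" and s: "s \<ge> 5" "odd s" and p: "p = (s - 1) * t + 2" and n: "n \<ge> p"
    and d: "(2 * p)\<^sup>2 < d" "2 * n\<^sup>2 * (4 * s * p\<^sup>2) ^ (s - 1) < (d - 16 * p * s) ^ s"
  shows "n\<^sup>2 \<le> 8 * ramsey_r (complete_bipartite n n) (complete_bipartite p p) (p\<^sup>2 - s * t + 1) * (d + 4 * p)"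
proof -
  define G where "G = complete_bipartite n n"
  define H where "H = complete_bipartite p p"
  define q where "q = p\<^sup>2 - s * t + 1"
  define V :: "(nat + nat) set" where "V = {..<n} <+> {..<n}"
  \<comment> \<open>Both bounds serve to get \<open>q \<le> p\<^sup>2\<close> under truncated
    subtraction, as \<open>ramsey_r_attained\<close> demands.\<close>
  have "1 \<le> s * t" "1 \<le> p\<^sup>2" using s t p by auto
  then have "q \<le> card (edges H)"
    unfolding q_def H_def card_edges_complete_bipartite power2_eq_square by linarith
  moreover have "finite (edges G)"
    by (simp add: G_def edges_complete_bipartite)
  ultimately obtain c where c: "c ` edges G \<subseteq> {..<ramsey_r G H q}" "Hq_coloring G H q c"
    using ramsey_r_attained by blast
  interpret bipartite_coloring isl "\<lambda>u w. c {u, w}"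
    by unfold_locales (simp add: insert_commute)
  have half_V: "half True V = Inl ` {..<n}" "half False V = Inr ` {..<n}"
    by (auto simp: half_def V_def)
  have cross_edge: "{a, b} \<in> edges G" if "(a, b) \<in> cross V" for a b
    using that by (auto simp: cross_def half_V G_def complete_bipartite_def)
  interpret few_repeats isl "\<lambda>u w. c {u, w}" V n s t p
  proof unfold_locales
    show "finite V" by (simp add: V_def)
    show "card (half b V) = n" for b
      by (cases b) (simp_all add: half_V card_image)
    show "\<not> repeats U (s * t)" if U: "U \<subseteq> V" "\<And>b. card (half b U) = p" for U
    proof
      assume r: "repeats U (s * t)"
      let ?F = "\<lparr>verts = U, edges = (\<lambda>(a, b). {a, b}) ` ({v \<in> U. isl v} \<times> {v \<in> U. \<not> isl v})\<rparr>"
      have cross_U: "{v \<in> U. isl v} \<times> {v \<in> U. \<not> isl v} = cross U"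
        by (auto simp: cross_def half_def)
      have "finite U" using U(1) finite_subset by (fastforce simp: V_def)
      then have "isomorphic ?F H"
        unfolding H_def using U(2) [of True] U(2) [of False]
        by (intro isomorphic_complete_bipartite) (simp_all add: half_def)
      moreover have "subgraph ?F G"
      proof -
        have "cross U \<subseteq> cross V" using U(1) by (auto simp: cross_def half_def)
        then have "edges ?F \<subseteq> edges G" using cross_edge by (auto simp: cross_U)
        moreover have "card {a, b} = 2" if "isl a" "\<not> isl b" for a b :: "nat + nat"
          using that by (metis card_2_iff)
        then have "simple_graph ?F" by (auto simp: simple_graph_def)
        moreover have "verts ?F \<subseteq> verts G" using U(1) by (simp add: G_def V_def complete_bipartite_def)
        ultimately show ?thesis by (simp add: subgraph_def)
      qed
      ultimately have "q \<le> card (c ` edges ?F)"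
        using c(2) by (auto simp: Hq_coloring_def)
      also have "c ` edges ?F = colors U"
        by (simp add: cross_U colors_def image_image case_prod_unfold)
      finally have "q + s * t \<le> card (cross U)" using r by (simp add: repeats_def)
      also have "\<dots> = p\<^sup>2" by (simp add: cross_def card_cartesian_product U(2) power2_eq_square)
      finally show False by (simp add: q_def)
    qed
  qed (use assms in auto)
  have "colors V \<subseteq> {..<ramsey_r G H q}"
    using c(1) cross_edge by (auto simp: colors_def)
  then have "n\<^sup>2 \<le> 8 * card {..<ramsey_r G H q} * (d + M)"
    using d by (intro color_count) (simp_all add: M_def K_def)
  then show ?thesis by (simp add: M_def G_def H_def q_def)
qed

theorem theorem1p7:
  fixes s t p :: nat
  assumes "t \<ge> 2" and "s \<ge> 5" and "odd s" and "p = (s - 1) * t + 2"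
  shows "(\<lambda>n. real (ramsey_r (complete_bipartite n n) (complete_bipartite p p)
                      (p\<^sup>2 - s * t + 1)))
         \<in> \<Omega>(\<lambda>n. real n powr (2 - 2 / real s))"
proof -
  define r where "r n = ramsey_r (complete_bipartite n n) (complete_bipartite p p) (p\<^sup>2 - s * t + 1)" for n
  define K where "K = 4 * s * p\<^sup>2"
  define E where "E = (2 * p)\<^sup>2 + 1 + 16 * p * s"
  define B where "B = real (E + K + 1 + 4 * p)"
  have p: "p \<ge> 2" using assms by simp
  have "1 \<le> p\<^sup>2" using p by (simp add: power2_eq_square)
  then have "1 * 5 \<le> p\<^sup>2 * s" using assms(2) by (rule mult_le_mono)
  moreover have "K = 4 * (p\<^sup>2 * s)" by (simp add: K_def)
  ultimately have K: "2 < K" by linarith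
  have B: "B > 0" by (simp add: B_def)
  have "1 / (8 * B) * real n powr (2 - 2 / real s) \<le> real (r n)" if n: "n \<ge> p" for n
  proof -
    \<comment> \<open>\<open>y\<close> is the target order of magnitude of the degree, with
      \<open>y ^ s = n\<^sup>2\<close>.\<close>
    define y where "y = real n powr (2 / real s)"
    have n1: "real n \<ge> 1" using n p by simp
    then have y: "y \<ge> 1" by (simp add: y_def ge_one_powr_ge_zero)
    have "y ^ s = real n powr (2 / real s * real s)"
      using n1 by (simp add: y_def powr_powr flip: powr_realpow)
    then have y_pow: "y ^ s = (real n)\<^sup>2"
      using n1 assms by (simp add: powr_numeral)
    \<comment> \<open>\<open>E\<close> covers the requirement \<open>(2 * p)\<^sup>2 < d\<close> and
      the loss \<open>16 * p * s\<close>. What remains is at least \<open>K * y\<close>, whose power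
      \<open>K ^ s * n\<^sup>2\<close> beats \<open>2 * n\<^sup>2 * K ^ (s - 1)\<close> because
      \<open>K > 2\<close>.\<close>
    define d where "d = E + nat \<lceil>K * y\<rceil>"
    have "real (2 * n\<^sup>2 * K ^ (s - 1)) < real (K ^ s * n\<^sup>2)"
    proof -
      have "K ^ s = K * K ^ (s - 1)" using assms by (cases s) auto
      moreover have "2 * (K ^ (s - 1) * n\<^sup>2) < K * (K ^ (s - 1) * n\<^sup>2)"
        using K n1 by (intro mult_strict_right_mono) auto
      ultimately have "2 * n\<^sup>2 * K ^ (s - 1) < K ^ s * n\<^sup>2" by (simp add: mult_ac)
      then show ?thesis by (simp only: of_nat_less_iff)
    qed
    also have "\<dots> = (K * y) ^ s" by (simp add: power_mult_distrib y_pow)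
    also have "\<dots> \<le> real (nat \<lceil>K * y\<rceil>) ^ s"
      using y by (intro power_mono) (auto intro: real_nat_ceiling_ge)
    also have "\<dots> \<le> real ((d - 16 * p * s) ^ s)"
      unfolding of_nat_power by (intro power_mono) (auto simp: d_def E_def)
    finally have "2 * n\<^sup>2 * K ^ (s - 1) < (d - 16 * p * s) ^ s" by (simp only: of_nat_less_iff)
    moreover have "(2 * p)\<^sup>2 < d" by (simp add: d_def E_def)
    ultimately have "n\<^sup>2 \<le> 8 * r n * (d + 4 * p)"
      unfolding r_def using assms n by (intro ramsey_lower_bound) (auto simp: K_def)
    then have "real (n\<^sup>2) \<le> real (8 * r n * (d + 4 * p))" by (simp only: of_nat_le_iff)
    also have "\<dots> = 8 * real (r n) * real (d + 4 * p)" by simp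
    also have "\<dots> \<le> 8 * real (r n) * (B * y)"
    proof (intro mult_left_mono)
      \<comment> \<open>The summand 1 pays for the ceiling; as \<open>y \<ge> 1\<close>, all
        constants can then be absorbed into a multiple of \<open>y\<close>.\<close>
      have "real (d + 4 * p) \<le> real (E + 1 + 4 * p) + K * y"
        using y of_nat_ceiling [of "K * y"] by (simp add: d_def) linarith
      also have "\<dots> \<le> real (E + 1 + 4 * p) * y + K * y"
        using y mult_left_mono [of 1 y "real (E + 1 + 4 * p)"] by simp
      also have "\<dots> = B * y" by (simp add: B_def algebra_simps)
      finally show "real (d + 4 * p) \<le> B * y" .
    qed auto
    finally have "(real n)\<^sup>2 / y \<le> 8 * B * real (r n)"
      using y by (simp add: divide_le_eq mult_ac)
    moreover have "(real n)\<^sup>2 / y = real n powr (2 - 2 / real s)"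
      using n1 by (simp add: y_def powr_diff powr_numeral)
    ultimately show ?thesis using B by (simp add: divide_le_eq mult.commute)
  qed
  then have "\<forall>\<^sub>F n in sequentially. norm (real (r n)) \<ge> 1 / (8 * B) * norm (real n powr (2 - 2 / real s))"
    by (intro eventually_sequentiallyI [of p]) simp
  then have "(\<lambda>n. real (r n)) \<in> \<Omega>(\<lambda>n. real n powr (2 - 2 / real s))"
    using B by (intro landau_omega.bigI [of "1 / (8 * B)"]) auto
  then show ?thesis by (simp add: r_def)
qed

end
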